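(* Let $f\colon\mathbb{S}^1\to\mathbb{S}^1$ be a $C^2$ orientation preserving endomorphism of the circle with finitely many turning points. Suppose that $f$ satisfies the $\alpha$-Hölder shadowing property with $\alpha>\frac12$. If $f$ is $C^r$-robustly transitive for some $r\ge 1$, then $f$ is an expanding endomorphism.
   Context: $\mathbb{S}^1=\mathbb{R}/\mathbb{Z}$ with its usual distance $d$. An endomorphism of the circle is a (not necessarily invertible) map $\mathbb{S}^1\to\mathbb{S}^1$ of the stated smoothness; it is orientation preserving if its degree is positive. A point $c$ is a turning point of $f$ if $f'(c)=0$ and $c$ is a local minimum or a local maximum of $f$ (in local coordinates, i.e. of a lift of $f$ to $\mathbb{R}$). A map is transitive if it has a dense forward orbit. $f$ is $C^r$-robustly transitive if $f$ is of class $C^r$ and all maps in some $C^r$-neighborhood of $f$ are transitive. For $\epsilon>0$, an $\epsilon$-pseudo-orbit of $f$ is a sequence $\{x_n\}_{n\ge 0}$ with $d(f(x_n),x_{n+1})<\epsilon$ for all $n\ge 0$; it is $\eta$-shadowed by the orbit of $x$ if $d(f^n(x),x_n)<\eta$ for all $n\ge 0$. For $\alpha\le 1$, $f$ has the $\alpha$-Hölder shadowing property if there exists $C>0$ such that for every $\epsilon>0$, any $\epsilon$-pseudo-orbit is $C\epsilon^\alpha$-shadowed by an orbit of $f$. $f$ is expanding if there exist $C>0$ and $\lambda>1$ such that $|(f^n)'(x)|>C\lambda^n$ for every $x\in\mathbb{S}^1$ and every positive integer $n$. *)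

theory Defs
  imports "HOL-Analysis.Analysis"
begin

section \<open>The circle as a metric space\<close>

definition int_cong :: "real \<Rightarrow> real \<Rightarrow> bool" where
  "int_cong x y \<longleftrightarrow> x - y \<in> \<int>"

lemma equivp_int_cong: "equivp int_cong"
proof (rule equivpI)
  show "reflp int_cong"
    by (auto simp: reflp_def int_cong_def)
  show "symp int_cong"
    unfolding symp_def int_cong_def by (metis Ints_minus minus_diff_eq)
  show "transp int_cong"
    unfolding transp_def int_cong_def by (metis Ints_add diff_add_cancel add_diff_eq)
qed

quotient_type circle = real / int_cong
  by (rule equivp_int_cong)

lift_definition circle_of :: "real \<Rightarrow> circle" is "\<lambda>x. x" .

lemma circle_of_eq_iff: "circle_of x = circle_of y \<longleftrightarrow> x - y \<in> \<int>"
  by transfer (simp add: int_cong_def)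

lemma circle_of_surj: "\<exists>x. circle_of x = p"
  by transfer (metis Ints_0 diff_self int_cong_def)

lemma round_add_int: "round (x + of_int n) = round (x :: real) + n"
  unfolding round_def by (metis add.assoc add.commute floor_add_int)

lemma abs_minus_round_le: "n \<in> \<int> \<Longrightarrow> \<bar>z - of_int (round z)\<bar> \<le> \<bar>z - (n :: real)\<bar>"
  by (elim Ints_cases) (simp add: round_diff_minimal)

instantiation circle :: metric_space
begin

text \<open>The distance of two classes is the smallest distance of their representatives, which
  for representatives \<open>x\<close>, \<open>y\<close> is the distance from \<open>x - y\<close> to the nearest integer.\<close>

lift_definition dist_circle :: "circle \<Rightarrow> circle \<Rightarrow> real" is
  "\<lambda>x y. \<bar>(x - y) - of_int (round (x - y))\<bar>"
proof -
  fix x x' y y' :: real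
  assume "int_cong x x'" "int_cong y y'"
  then have "(x - y) - (x' - y') \<in> \<int>"
    unfolding int_cong_def by (metis Ints_diff diff_diff_eq2 diff_diff_add add.commute add_diff_eq diff_add_eq)
  then obtain n where "x - y = (x' - y') + of_int n"
    by (elim Ints_cases) (simp add: algebra_simps)
  then show "\<bar>(x - y) - of_int (round (x - y))\<bar> = \<bar>(x' - y') - of_int (round (x' - y'))\<bar>"
    by (simp add: round_add_int)
qed

definition uniformity_circle :: "(circle \<times> circle) filter" where
  "uniformity_circle = (INF e\<in>{0<..}. principal {(x, y). dist x y < e})"

definition open_circle :: "circle set \<Rightarrow> bool" where
  "open_circle U \<longleftrightarrow> (\<forall>x\<in>U. eventually (\<lambda>(x', y). x' = x \<longrightarrow> y \<in> U) uniformity)"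

instance
proof
  show "uniformity = (INF e\<in>{0<..}. principal {(x, y :: circle). dist x y < e})"
    by (rule uniformity_circle_def)
  show "open U \<longleftrightarrow> (\<forall>x\<in>U. \<forall>\<^sub>F (x', y) in uniformity. x' = x \<longrightarrow> y \<in> U)" for U :: "circle set"
    by (rule open_circle_def)
  show "dist p q = 0 \<longleftrightarrow> p = q" for p q :: circle
  proof transfer
    fix x y :: real
    show "\<bar>(x - y) - of_int (round (x - y))\<bar> = 0 \<longleftrightarrow> int_cong x y"
      unfolding int_cong_def
      using abs_minus_round_le[of "x - y" "x - y"] by (auto, metis Ints_of_int)
  qed
  show "dist p q \<le> dist p s + dist q s" for p q s :: circle
  proof transfer
    fix x y z :: real
    define m n where "m = round (x - z)" and "n = round (y - z)"
    have "\<bar>(x - y) - of_int (round (x - y))\<bar> \<le> \<bar>(x - y) - of_int (m - n)\<bar>"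
      by (rule round_diff_minimal)
    also have "\<dots> \<le> \<bar>(x - z) - of_int m\<bar> + \<bar>(y - z) - of_int n\<bar>"
      by simp
    finally show "\<bar>(x - y) - of_int (round (x - y))\<bar>
        \<le> \<bar>(x - z) - of_int (round (x - z))\<bar> + \<bar>(y - z) - of_int (round (y - z))\<bar>"
      by (simp add: m_def n_def)
  qed
qed

end

lemma dist_circle_of:
  "dist (circle_of x) (circle_of y) = \<bar>(x - y) - of_int (round (x - y))\<bar>"
  by transfer simp

section \<open>Lifts, degree and smoothness of circle maps\<close>

definition circle_lift :: "(circle \<Rightarrow> circle) \<Rightarrow> (real \<Rightarrow> real) \<Rightarrow> bool" where
  "circle_lift f F \<longleftrightarrow> continuous_on UNIV F \<and> (\<forall>x. circle_of (F x) = f (circle_of x))"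

lemma continuous_Ints_constant:
  fixes F :: "real \<Rightarrow> real"
  assumes "continuous_on UNIV F" "\<And>x. F x \<in> \<int>"
  shows "F x = F y"
proof -
  have "F constant_on UNIV"
  proof (rule continuous_discrete_range_constant[OF connected_UNIV assms(1)])
    fix x :: real
    have "1 \<le> norm (F y - F x)" if "F y \<noteq> F x" for y
      using that assms(2)[of x] assms(2)[of y]
      by (metis Ints_diff Ints_nonzero_abs_ge1 eq_iff_diff_eq_0 real_norm_def)
    then show "\<exists>e>0. \<forall>y. y \<in> UNIV \<and> F y \<noteq> F x \<longrightarrow> e \<le> norm (F y - F x)"
      by (intro exI[of _ 1]) auto
  qed
  then show ?thesis
    by (auto simp: constant_on_def)
qed

lemma circle_lift_unique:
  assumes "circle_lift f F" "circle_lift f G"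
  obtains n :: int where "\<And>x. G x = F x + of_int n"
proof -
  have "G x - F x \<in> \<int>" for x
    using assms by (metis circle_lift_def circle_of_eq_iff)
  moreover from this have "G x - F x = G 0 - F 0" for x
    using assms
    by (intro continuous_Ints_constant[of "\<lambda>x. G x - F x"])
       (auto simp: circle_lift_def intro: continuous_on_diff)
  ultimately show thesis
    using that by (metis Ints_cases add.commute diff_add_cancel)
qed

lemma circle_lift_shift:
  assumes "circle_lift f F"
  shows "\<exists>d :: int. \<forall>x. F (x + 1) = F x + of_int d"
proof -
  have "circle_of (x + 1) = circle_of x" for x
    by (simp add: circle_of_eq_iff)
  then have "circle_lift f (\<lambda>x. F (x + 1))"
    using assms unfolding circle_lift_def
    by (auto intro!: continuous_intros continuous_on_compose2[of UNIV F])
  then show ?thesis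
    using circle_lift_unique[OF assms] by metis
qed

definition circle_degree :: "(circle \<Rightarrow> circle) \<Rightarrow> int" where
  "circle_degree f = (THE d. \<exists>F. circle_lift f F \<and> (\<forall>x. F (x + 1) = F x + of_int d))"

lemma circle_degree_lift:
  assumes "circle_lift f F"
  shows "F (x + 1) = F x + of_int (circle_degree f)"
proof -
  have "\<exists>!d :: int. \<exists>F. circle_lift f F \<and> (\<forall>x. F (x + 1) = F x + of_int d)"
  proof (rule ex_ex1I)
    show "\<exists>d :: int. \<exists>F. circle_lift f F \<and> (\<forall>x. F (x + 1) = F x + of_int d)"
      using circle_lift_shift[OF assms] assms by blast
  next
    fix d d' :: int
    assume "\<exists>F. circle_lift f F \<and> (\<forall>x. F (x + 1) = F x + of_int d)"
      and "\<exists>F. circle_lift f F \<and> (\<forall>x. F (x + 1) = F x + of_int d')"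
    then obtain F G where F: "circle_lift f F" "\<And>x. F (x + 1) = F x + of_int d"
      and G: "circle_lift f G" "\<And>x. G (x + 1) = G x + of_int d'" by blast
    obtain n where "\<And>x. G x = F x + of_int n"
      using circle_lift_unique[OF F(1) G(1)] by blast
    then show "d = d'"
      using F(2)[of 0] G(2)[of 0] by simp
  qed
  then obtain G where G: "circle_lift f G" "\<And>x. G (x + 1) = G x + of_int (circle_degree f)"
    using theI'[of "\<lambda>d :: int. \<exists>F. circle_lift f F \<and> (\<forall>x. F (x + 1) = F x + of_int d)"]
    unfolding circle_degree_def by blast
  obtain n where "\<And>x. G x = F x + of_int n"
    using circle_lift_unique[OF assms G(1)] by blast
  then show ?thesis
    using G(2)[of x] by simp
qed

definition orientation_preserving :: "(circle \<Rightarrow> circle) \<Rightarrow> bool" where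
  "orientation_preserving f \<longleftrightarrow> circle_degree f > 0"

definition circle_deriv :: "(circle \<Rightarrow> circle) \<Rightarrow> circle \<Rightarrow> real" where
  "circle_deriv f p =
    (THE D. \<exists>F x. circle_lift f F \<and> circle_of x = p \<and> (F has_real_derivative D) (at x))"

lemma circle_deriv_lift:
  assumes F: "circle_lift f F" and D: "(F has_real_derivative D) (at x)"
  shows "circle_deriv f (circle_of x) = D"
  unfolding circle_deriv_def
proof (rule the_equality)
  show "\<exists>F y. circle_lift f F \<and> circle_of y = circle_of x \<and> (F has_real_derivative D) (at y)"
    using assms by blast
next
  fix D'
  assume "\<exists>F y. circle_lift f F \<and> circle_of y = circle_of x \<and> (F has_real_derivative D') (at y)"
  then obtain G y where G: "circle_lift f G" "(G has_real_derivative D') (at y)"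
    and y: "circle_of y = circle_of x" by blast
  from y obtain k :: int where k: "y = x + of_int k"
    unfolding circle_of_eq_iff by (metis Ints_cases add.commute diff_add_cancel)
  have "circle_of (u + of_int k) = circle_of u" for u
    by (simp add: circle_of_eq_iff)
  then have "circle_lift f (\<lambda>u. G (u + of_int k))"
    using G(1) unfolding circle_lift_def
    by (auto intro!: continuous_intros continuous_on_compose2[of UNIV G])
  then obtain n :: int where "\<And>u. G (u + of_int k) = F u + of_int n"
    using circle_lift_unique[OF F] by metis
  then have eq: "(\<lambda>u. G (u + of_int k)) = (\<lambda>u. F u + of_int n)"
    by blast
  have "((\<lambda>u. G (u + of_int k)) has_real_derivative D') (at x)"
    using G(2) by (simp add: k DERIV_shift)
  moreover have "((\<lambda>u. F u + of_int n) has_real_derivative D) (at x)"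
    using D by (auto intro!: derivative_eq_intros)
  ultimately show "D' = D"
    unfolding eq by (rule DERIV_unique)
qed

definition C_class :: "nat \<Rightarrow> (real \<Rightarrow> real) \<Rightarrow> bool" where
  "C_class r F \<longleftrightarrow>
    (\<forall>k<r. \<forall>x. (deriv ^^ k) F differentiable (at x)) \<and> continuous_on UNIV ((deriv ^^ r) F)"

definition circle_C_class :: "nat \<Rightarrow> (circle \<Rightarrow> circle) \<Rightarrow> bool" where
  "circle_C_class r f \<longleftrightarrow> (\<exists>F. circle_lift f F \<and> C_class r F)"

text \<open>Non-strict extrema: every point of an interval on which \<open>f\<close> is constant is a turning point.\<close>

definition turning_point :: "(circle \<Rightarrow> circle) \<Rightarrow> circle \<Rightarrow> bool" where
  "turning_point f c \<longleftrightarrow> circle_deriv f c = 0 \<and>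
    (\<exists>F x. circle_lift f F \<and> circle_of x = c \<and>
      ((\<forall>\<^sub>F y in nhds x. F x \<le> F y) \<or> (\<forall>\<^sub>F y in nhds x. F y \<le> F x)))"

section \<open>Dynamics\<close>

definition transitive :: "('a :: topological_space \<Rightarrow> 'a) \<Rightarrow> bool" where
  "transitive f \<longleftrightarrow> (\<exists>x. closure (range (\<lambda>n. (f ^^ n) x)) = UNIV)"

text \<open>The sets \<open>{g. C_close r \<epsilon> f g}\<close> for \<open>\<epsilon> > 0\<close> form a basis of neighbourhoods of \<open>f\<close> in the
  \<open>C\<^sup>r\<close> topology on the circle maps of class \<open>C\<^sup>r\<close>: uniform closeness of the maps, expressed by
  suitable lifts, and of their derivatives up to order \<open>r\<close>.\<close>

definition C_close :: "nat \<Rightarrow> real \<Rightarrow> (circle \<Rightarrow> circle) \<Rightarrow> (circle \<Rightarrow> circle) \<Rightarrow> bool" where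
  "C_close r \<epsilon> f g \<longleftrightarrow>
    (\<exists>F G. circle_lift f F \<and> circle_lift g G \<and> C_class r F \<and> C_class r G \<and>
      (\<forall>k\<le>r. \<forall>x. \<bar>(deriv ^^ k) F x - (deriv ^^ k) G x\<bar> < \<epsilon>))"

definition robustly_transitive :: "nat \<Rightarrow> (circle \<Rightarrow> circle) \<Rightarrow> bool" where
  "robustly_transitive r f \<longleftrightarrow>
    circle_C_class r f \<and> (\<exists>\<epsilon>>0. \<forall>g. C_close r \<epsilon> f g \<longrightarrow> transitive g)"

definition pseudo_orbit :: "('a :: metric_space \<Rightarrow> 'a) \<Rightarrow> real \<Rightarrow> (nat \<Rightarrow> 'a) \<Rightarrow> bool" where
  "pseudo_orbit f \<epsilon> X \<longleftrightarrow> (\<forall>n. dist (f (X n)) (X (Suc n)) < \<epsilon>)"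

definition shadowed_by :: "('a :: metric_space \<Rightarrow> 'a) \<Rightarrow> real \<Rightarrow> (nat \<Rightarrow> 'a) \<Rightarrow> 'a \<Rightarrow> bool" where
  "shadowed_by f \<eta> X x \<longleftrightarrow> (\<forall>n. dist ((f ^^ n) x) (X n) < \<eta>)"

definition Holder_shadowing :: "real \<Rightarrow> ('a :: metric_space \<Rightarrow> 'a) \<Rightarrow> bool" where
  "Holder_shadowing \<alpha> f \<longleftrightarrow>
    (\<exists>C>0. \<forall>\<epsilon>>0. \<forall>X. pseudo_orbit f \<epsilon> X \<longrightarrow> (\<exists>x. shadowed_by f (C * \<epsilon> powr \<alpha>) X x))"

definition expanding :: "(circle \<Rightarrow> circle) \<Rightarrow> bool" where
  "expanding f \<longleftrightarrow>
    (\<exists>C>0. \<exists>\<Lambda>>1. \<forall>p. \<forall>n\<ge>1. \<bar>circle_deriv (f ^^ n) p\<bar> > C * \<Lambda> ^ n)"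

end

theory Submission
  imports Defs
begin

text \<open>Let \<open>F\<close> be a lift of \<open>f\<close>. At a critical point \<open>c\<close> the map is quadratic, so a shadowing exponent
  above \<open>1 / 2\<close> forces every orbit that starts near \<open>F c\<close> to stay near the orbit of \<open>F c\<close>. For a transitive map this
  equicontinuity makes some iterates arbitrarily close to the identity, so \<open>f\<close> is injective, of degree 1;
  but then a small rotation of \<open>f\<close> has a periodic point and is not transitive. Hence \<open>F' > 0\<close>, the degree is
  at least 2, and transitivity makes \<open>f\<close> expansive. If some orbit expanded by at most a factor 2 during a
  time \<open>N\<close>, the pseudo-orbits \<open>F y\<^sub>i = y\<^sub>i\<^sub>+\<^sub>1 + s\<close> ending on it would drift away from
  it by at least order \<open>s N\<close>; for \<open>N\<close> of order \<open>s\<^bsup>-\<alpha>\<^esup>\<close> this exceeds the distance of order \<open>s\<^bsup>\<alpha>\<^esup>\<close> that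
  shadowing allows, once more because \<open>\<alpha> > 1 / 2\<close>.\<close>

section \<open>Lifts to the real line\<close>

lemma dist_circle_of_le: "dist (circle_of x) (circle_of y) \<le> \<bar>x - y\<bar>"
  using round_diff_minimal[of "x - y" 0] by (simp add: dist_circle_of)

lemma dist_circle_of_eq:
  assumes "\<bar>x - y\<bar> < 1 / 2"
  shows "dist (circle_of x) (circle_of y) = \<bar>x - y\<bar>"
proof -
  have "round (x - y) = 0"
    using assms by (intro round_unique') auto
  then show ?thesis by (simp add: dist_circle_of)
qed

lemma circle_of_add_int [simp]: "circle_of (x + of_int k) = circle_of x"
  by (simp add: circle_of_eq_iff)

lemma circle_of_eqE:
  assumes "circle_of x = circle_of y"
  obtains k :: int where "x = y + of_int k"
  using assms unfolding circle_of_eq_iff by (metis Ints_cases add.commute diff_add_cancel)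

text \<open>Subtracting the integer that realises the circle distance gives the representative.
  Small distances on the circle thus become small distances between lifts.\<close>

lemma dist_circle_representative:
  assumes "dist p (circle_of y) < e"
  obtains x where "circle_of x = p" "\<bar>x - y\<bar> < e"
proof -
  obtain x where x: "circle_of x = p"
    using circle_of_surj by blast
  have "circle_of (x + of_int (- round (x - y))) = p"
    by (simp only: circle_of_add_int x)
  moreover have "\<bar>(x + of_int (- round (x - y))) - y\<bar> < e"
    using assms unfolding x[symmetric] dist_circle_of by (simp add: algebra_simps)
  ultimately show thesis by (rule that)
qed

lemma isCont_circle_of: "isCont circle_of x"
  unfolding continuous_at_eps_delta
proof (intro allI impI)
  fix e :: real assume "0 < e"
  then show "\<exists>d>0. \<forall>x'. dist x' x < d \<longrightarrow> dist (circle_of x') (circle_of x) < e"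
    using dist_circle_of_le by (intro exI[of _ e]) (metis dist_real_def le_less_trans)
qed

instance circle :: perfect_space
proof
  fix p :: circle
  show "\<not> open {p}"
  proof
    assume "open {p}"
    then obtain e where e: "e > 0" "ball p e \<subseteq> {p}"
      by (meson insertI1 open_contains_ball)
    obtain x where x: "circle_of x = p"
      using circle_of_surj by blast
    define h where "h = min (e / 2) (1 / 4)"
    have h: "0 < h" "h < e" "h < 1 / 2"
      using e(1) by (auto simp: h_def)
    have "dist (circle_of (x + h)) p = h"
      using dist_circle_of_eq[of "x + h" x] h by (simp add: x)
    with h e(2) have "circle_of (x + h) = p"
      by (auto simp: dist_commute subset_iff)
    with \<open>dist (circle_of (x + h)) p = h\<close> h show False by simp
  qed
qed

lemma circle_lift_apply: "circle_lift f F \<Longrightarrow> f (circle_of x) = circle_of (F x)"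
  by (simp add: circle_lift_def)

lemma circle_lift_continuous: "circle_lift f F \<Longrightarrow> continuous_on UNIV F"
  by (simp add: circle_lift_def)

lemma circle_lift_funpow:
  assumes "circle_lift f F"
  shows "circle_lift (f ^^ n) (F ^^ n)"
proof (induction n)
  case 0
  show ?case by (simp add: circle_lift_def)
next
  case (Suc n)
  then show ?case
    using assms unfolding circle_lift_def
    by (auto intro: continuous_on_compose2[of UNIV F UNIV "F ^^ n"])
qed

lemma circle_lift_isCont:
  assumes "circle_lift f F"
  shows "isCont f p"
  unfolding continuous_at_eps_delta
proof (intro allI impI)
  fix e :: real assume e: "0 < e"
  obtain x where x: "circle_of x = p"
    using circle_of_surj by blast
  have "isCont F x"
    using circle_lift_continuous[OF assms] by (simp add: continuous_on_eq_continuous_at)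
  then obtain d where d: "d > 0" "\<And>y. \<bar>y - x\<bar> < d \<Longrightarrow> \<bar>F y - F x\<bar> < e"
    using e unfolding continuous_at_eps_delta dist_real_def by blast
  have "dist (f q) (f p) < e" if q: "dist q p < d" for q
  proof -
    obtain y where "circle_of y = q" "\<bar>y - x\<bar> < d"
      using dist_circle_representative q x by metis
    then show ?thesis
      using d(2) dist_circle_of_le[of "F y" "F x"] x circle_lift_apply[OF assms]
      by (metis le_less_trans)
  qed
  with d(1) show "\<exists>d>0. \<forall>q. dist q p < d \<longrightarrow> dist (f q) (f p) < e" by blast
qed

lemma circle_degree_lift_int:
  assumes "circle_lift f F"
  shows "F (x + of_int k) = F x + of_int (circle_degree f * k)"
proof (induction k rule: int_induct[where k = 0])
  case base
  show ?case by simp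
next
  case (step1 k)
  then show ?case
    using circle_degree_lift[OF assms, of "x + of_int k"] by (simp add: algebra_simps)
next
  case (step2 k)
  then show ?case
    using circle_degree_lift[OF assms, of "x + of_int (k - 1)"] by (simp add: algebra_simps)
qed

lemma strict_mono_funpow:
  fixes F :: "'a :: order \<Rightarrow> 'a"
  shows "strict_mono F \<Longrightarrow> strict_mono (F ^^ n)"
  by (induction n) (auto simp: strict_mono_def)

section \<open>Transitive circle maps\<close>

lemma infinite_open:
  fixes U :: "'a :: {perfect_space, t1_space} set"
  assumes "open U" "U \<noteq> {}"
  shows "infinite U"
proof
  assume "finite U"
  obtain u where "u \<in> U" using assms(2) by blast
  have "open (U - (U - {u}))"
    using assms(1) \<open>finite U\<close> by (intro open_Diff finite_imp_closed) auto
  moreover have "U - (U - {u}) = {u}" using \<open>u \<in> U\<close> by blast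
  ultimately show False by (simp add: not_open_singleton)
qed

text \<open>Deleting the first \<open>N\<close> points of the dense orbit from \<open>U\<close>
  leaves an open set, nonempty because \<open>U\<close> is infinite, which the orbit must still
  meet. So visits can be taken arbitrarily late.\<close>

lemma transitive_visits:
  fixes f :: "'a :: {perfect_space, t1_space} \<Rightarrow> 'a"
  assumes "transitive f"
  obtains x where "\<And>U N. open U \<Longrightarrow> U \<noteq> {} \<Longrightarrow> \<exists>n\<ge>N. (f ^^ n) x \<in> U"
proof -
  obtain x where x: "closure (range (\<lambda>n. (f ^^ n) x)) = UNIV"
    using assms by (auto simp: transitive_def)
  have "\<exists>n\<ge>N. (f ^^ n) x \<in> U" if U: "open U" "U \<noteq> {}" for U N
  proof -
    let ?V = "U - (\<lambda>n. (f ^^ n) x) ` {..<N}"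
    have "infinite U"
      using U by (rule infinite_open)
    then have "?V \<noteq> {}"
      by (metis Diff_eq_empty_iff finite_imageI finite_lessThan finite_subset)
    moreover have "open ?V"
      using U(1) by (intro open_Diff finite_imp_closed) auto
    ultimately have "?V \<inter> range (\<lambda>n. (f ^^ n) x) \<noteq> {}"
      using x open_Int_closure_eq_empty[of ?V "range (\<lambda>n. (f ^^ n) x)"] by auto
    then obtain n where "(f ^^ n) x \<in> ?V" by blast
    then show ?thesis by (metis DiffD1 DiffD2 imageI lessThan_iff not_le)
  qed
  then show thesis by (rule that)
qed

lemma transitive_visits_interval:
  assumes "transitive f" "circle_lift f F"
  obtains x where "\<And>u v N. u < v \<Longrightarrow> \<exists>n\<ge>N. \<exists>j::int. u < (F ^^ n) x + of_int j \<and> (F ^^ n) x + of_int j < v"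
proof -
  obtain p where p: "\<And>U N. open U \<Longrightarrow> U \<noteq> {} \<Longrightarrow> \<exists>n\<ge>N. (f ^^ n) p \<in> U"
    using transitive_visits[OF assms(1)] by blast
  obtain x where x: "circle_of x = p"
    using circle_of_surj by blast
  have "\<exists>n\<ge>N. \<exists>j::int. u < (F ^^ n) x + of_int j \<and> (F ^^ n) x + of_int j < v" if "u < v" for u v N
  proof -
    define m where "m = (u + v) / 2"
    obtain n where n: "n \<ge> N" "(f ^^ n) p \<in> ball (circle_of m) ((v - u) / 2)"
      using p[of "ball (circle_of m) ((v - u) / 2)" N] \<open>u < v\<close> by auto
    then obtain y where y: "circle_of y = (f ^^ n) p" "\<bar>y - m\<bar> < (v - u) / 2"
      using dist_circle_representative[of "(f ^^ n) p" m "(v - u) / 2"] by (auto simp: dist_commute)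
    have "circle_of y = circle_of ((F ^^ n) x)"
      using y(1) x circle_lift_apply[OF circle_lift_funpow[OF assms(2)]] by metis
    then obtain j where "y = (F ^^ n) x + of_int j"
      by (rule circle_of_eqE)
    moreover have "u < y" "y < v"
      using y(2) by (auto simp: m_def field_simps abs_less_iff)
    ultimately show ?thesis using n(1) by blast
  qed
  then show thesis by (rule that)
qed

lemma funpow_shift:
  fixes F :: "real \<Rightarrow> real"
  assumes "circle_lift f F" "circle_of a = circle_of b"
  shows "circle_of ((F ^^ n) a) = circle_of ((F ^^ n) b)"
  using assms circle_lift_apply[OF circle_lift_funpow[OF assms(1)]] by metis

text \<open>An orbit that enters the trapping interval converges monotonically, under \<open>\<Phi>\<close>, to a periodic
  orbit, so it is not dense.\<close>

lemma not_transitive_if_trapping_interval: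
  fixes F :: "real \<Rightarrow> real" and z :: int
  assumes F: "circle_lift f F" "mono F" and n: "n \<ge> 1" and uv: "u < v"
    and u: "u \<le> (F ^^ n) u - of_int z" and v: "(F ^^ n) v - of_int z \<le> v"
  shows "\<not> transitive f"
proof
  assume "transitive f"
  then obtain p where p: "\<And>U N. open U \<Longrightarrow> U \<noteq> {} \<Longrightarrow> \<exists>n\<ge>N. (f ^^ n) p \<in> U"
    using transitive_visits by blast
  define \<Phi> where "\<Phi> = (\<lambda>x. (F ^^ n) x - of_int z)"
  have mono_\<Phi>: "\<Phi> x \<le> \<Phi> y" if "x \<le> y" for x y
    using funpow_mono[OF F(2) that] by (simp add: \<Phi>_def)
  have circle_\<Phi>: "circle_of (\<Phi> x) = (f ^^ n) (circle_of x)" for x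
    unfolding \<Phi>_def using circle_of_add_int[of "(F ^^ n) x" "- z"]
      circle_lift_apply[OF circle_lift_funpow[OF F(1)], of n x] by simp
  have "isCont (F ^^ n) x" for x
    using circle_lift_continuous[OF circle_lift_funpow[OF F(1)]]
    by (simp add: continuous_on_eq_continuous_at)
  then have cont_\<Phi>: "isCont \<Phi> x" for x
    unfolding \<Phi>_def by (intro continuous_intros)
  obtain m where m: "(f ^^ m) p \<in> ball (circle_of ((u + v) / 2)) ((v - u) / 2)"
    using p[of "ball (circle_of ((u + v) / 2)) ((v - u) / 2)" 0] uv by auto
  then obtain y where y: "circle_of y = (f ^^ m) p" "\<bar>y - (u + v) / 2\<bar> < (v - u) / 2"
    using dist_circle_representative[of "(f ^^ m) p" "(u + v) / 2" "(v - u) / 2"]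
    by (auto simp: dist_commute)
  define Y where "Y k = (\<Phi> ^^ k) y" for k
  have Y_Suc: "Y (Suc k) = \<Phi> (Y k)" for k by (simp add: Y_def)
  have "Y k \<in> {u..v}" for k
  proof (induction k)
    case 0
    have "u \<le> y" "y \<le> v"
      using y(2) by (auto simp: field_simps abs_less_iff)
    then show ?case by (simp add: Y_def)
  next
    case (Suc k)
    then show ?case
      using mono_\<Phi>[of u "Y k"] mono_\<Phi>[of "Y k" v] u v by (auto simp: Y_Suc \<Phi>_def)
  qed
  then have "Bseq Y"
    by (intro BseqI'[of _ "\<bar>u\<bar> + \<bar>v\<bar>"]) (smt (verit) atLeastAtMost_iff real_norm_def)
  moreover have "monoseq Y"
  proof (cases "y \<le> \<Phi> y")
    case True
    have "Y k \<le> Y (Suc k)" for k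
      by (induction k) (use True mono_\<Phi> in \<open>auto simp: Y_def\<close>)
    then show ?thesis by (simp add: monoseq_Suc)
  next
    case False
    have "Y (Suc k) \<le> Y k" for k
      by (induction k) (use False mono_\<Phi> in \<open>auto simp: Y_def\<close>)
    then show ?thesis by (simp add: monoseq_Suc)
  qed
  ultimately obtain q where q: "Y \<longlonglongrightarrow> q"
    using Bseq_monoseq_convergent convergent_def by blast
  \<comment> \<open>The orbit of \<open>p\<close> accumulates only on the finite set
    \<open>Q\<close>. A point \<open>s\<close> off \<open>Q\<close> has positive distance
    \<open>e\<close> from it, yet density brings the orbit within \<open>e / 2\<close> of
    \<open>s\<close> at a late time \<open>l\<close>.\<close>
  define Q where "Q = (\<lambda>i. (f ^^ i) (circle_of q)) ` {..<n}"
  have "finite Q" by (simp add: Q_def)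
  then obtain s where s: "s \<notin> Q"
    using infinite_open[of "UNIV :: circle set"] by (meson UNIV_not_empty ex_new_if_finite open_UNIV)
  obtain e where e: "e > 0" "\<And>t. t \<in> Q \<Longrightarrow> e \<le> dist s t"
    using finite_set_avoid[OF \<open>finite Q\<close>, of s] s by metis
  have "(\<lambda>k. (f ^^ i) (circle_of (Y k))) \<longlonglongrightarrow> (f ^^ i) (circle_of q)" for i
    by (intro isCont_tendsto_compose[OF circle_lift_isCont[OF circle_lift_funpow[OF F(1)]]]
        isCont_tendsto_compose[OF isCont_circle_of] q)
  then have "\<forall>\<^sub>F k in sequentially. \<forall>i\<in>{..<n}. dist ((f ^^ i) (circle_of (Y k))) ((f ^^ i) (circle_of q)) < e / 2"
    using e(1) by (intro eventually_ball_finite ballI tendstoD) auto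
  then obtain K where K: "\<And>k i. k \<ge> K \<Longrightarrow> i < n \<Longrightarrow>
      dist ((f ^^ i) (circle_of (Y k))) ((f ^^ i) (circle_of q)) < e / 2"
    unfolding eventually_sequentially by auto
  obtain l where l: "l \<ge> m + n * K" "(f ^^ l) p \<in> ball s (e / 2)"
    using p[of "ball s (e / 2)" "m + n * K"] e(1) by auto
  \<comment> \<open>Of the time elapsed since \<open>m\<close>, \<open>k\<close> counts full
    applications of \<open>\<Phi>\<close> and \<open>i\<close> is the remaining phase.\<close>
  define k i where "k = (l - m) div n" and "i = (l - m) mod n"
  have "k \<ge> K"
    using l(1) n by (simp add: k_def less_eq_div_iff_mult_less_eq algebra_simps)
  have "i < n" using n by (simp add: i_def)
  have "l = i + n * k + m"
    using l(1) by (simp add: k_def i_def)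
  moreover have "circle_of (Y k) = (f ^^ (n * k)) (circle_of y)" for k
    by (induction k) (simp_all add: Y_def circle_\<Phi> funpow_add)
  ultimately have "(f ^^ l) p = (f ^^ i) (circle_of (Y k))"
    by (simp add: funpow_add y(1))
  then have "dist s ((f ^^ i) (circle_of q)) < e"
    using l(2) K[OF \<open>k \<ge> K\<close> \<open>i < n\<close>]
      dist_triangle_half_r[of "(f ^^ i) (circle_of (Y k))" s e "(f ^^ i) (circle_of q)"]
    by (simp add: dist_commute)
  moreover have "(f ^^ i) (circle_of q) \<in> Q"
    using \<open>i < n\<close> by (simp add: Q_def)
  ultimately show False using e(2) by fastforce
qed

text \<open>A dense orbit passing near \<open>v\<close> returns close to \<open>v\<close>, and by equicontinuity the return
  time gives an iterate of \<open>f\<close> that is uniformly close to the identity.\<close>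

lemma inj_if_transitive_and_stable_point:
  fixes f :: "'a :: {perfect_space, metric_space} \<Rightarrow> 'a"
  assumes "transitive f" and cont: "\<And>x. isCont f x"
    and stable: "\<And>e. e > 0 \<Longrightarrow> \<exists>d>0. \<forall>x k. dist x v < d \<longrightarrow> dist ((f ^^ k) x) ((f ^^ k) v) < e"
  shows "inj f"
proof (rule injI)
  fix a b assume ab: "f a = f b"
  obtain p where p: "\<And>U N. open U \<Longrightarrow> U \<noteq> {} \<Longrightarrow> \<exists>n\<ge>N. (f ^^ n) p \<in> U"
    using transitive_visits[OF assms(1)] by blast
  have cont_n: "isCont (f ^^ n) x" for n x
    by (induction n) (auto intro: isCont_o2[OF _ cont] simp: id_def)
  have "dist a b < e" if "e > 0" for e
  proof -
    obtain d where d: "d > 0" "\<And>x k. dist x v < d \<Longrightarrow> dist ((f ^^ k) x) ((f ^^ k) v) < e / 8"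
      using stable[of "e / 8"] \<open>e > 0\<close> by auto
    obtain m where m: "(f ^^ m) p \<in> ball v d"
      using p[of "ball v d" 0] d(1) by auto
    obtain l where l: "l \<ge> m + 1" "(f ^^ l) p \<in> ball v d"
      using p[of "ball v d" "m + 1"] d(1) by auto
    define n where "n = l - m"
    have n: "n \<ge> 1" "l = n + m" using l(1) by (auto simp: n_def)
    have close: "dist ((f ^^ n) ((f ^^ k) p)) ((f ^^ k) p) < e / 4" if "k \<ge> m" for k
    proof -
      obtain j where j: "k = j + m" using \<open>k \<ge> m\<close> by (metis le_add_diff_inverse2)
      have "(f ^^ n) ((f ^^ k) p) = (f ^^ j) ((f ^^ l) p)"
        using funpow_add[of n k f] funpow_add[of j l f] by (simp add: j n(2) ac_simps fun_eq_iff)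
      moreover have "dist ((f ^^ j) ((f ^^ l) p)) ((f ^^ j) v) < e / 8"
        and "dist ((f ^^ j) ((f ^^ m) p)) ((f ^^ j) v) < e / 8"
        using d(2)[of "(f ^^ l) p" j] d(2)[of "(f ^^ m) p" j] m l(2) by (simp_all add: dist_commute)
      ultimately show ?thesis
        using dist_triangle_half_l[of "(f ^^ j) ((f ^^ l) p)" "(f ^^ j) v" "e / 4" "(f ^^ j) ((f ^^ m) p)"]
        by (simp add: j funpow_add)
    qed
    \<comment> \<open>Density of the orbit after time \<open>m\<close> and continuity of
      \<open>f ^^ n\<close> carry the estimate from the orbit to every point.\<close>
    have near_id: "dist ((f ^^ n) x) x < e / 2" for x
    proof -
      obtain r where r: "r > 0" "\<And>y. dist y x < r \<Longrightarrow> dist ((f ^^ n) y) ((f ^^ n) x) < e / 8"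
        using cont_n[of x n] \<open>e > 0\<close> unfolding continuous_at_eps_delta
        by (metis divide_pos_pos zero_less_numeral)
      have "ball x (min r (e / 8)) \<noteq> {}"
        using r(1) \<open>e > 0\<close> by (simp add: ball_eq_empty)
      then obtain k where k: "k \<ge> m" "(f ^^ k) p \<in> ball x (min r (e / 8))"
        using p[OF open_ball, of x "min r (e / 8)" m] by blast
      define y where "y = (f ^^ k) p"
      have "dist y x < e / 8" "dist ((f ^^ n) y) ((f ^^ n) x) < e / 8" "dist ((f ^^ n) y) y < e / 4"
        using k r(2)[of y] close[OF k(1)] by (auto simp: y_def dist_commute)
      moreover have "dist ((f ^^ n) x) x \<le> dist ((f ^^ n) y) ((f ^^ n) x) + dist ((f ^^ n) y) y + dist y x"
        using dist_triangle[of "(f ^^ n) x" x y] dist_triangle[of "(f ^^ n) x" y "(f ^^ n) y"]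
        by (simp add: dist_commute)
      ultimately show ?thesis by linarith
    qed
    have "(f ^^ n) a = (f ^^ n) b"
      using n(1) ab by (metis One_nat_def Suc_le_D funpow_Suc_right o_apply)
    then show ?thesis
      using near_id[of a] near_id[of b] dist_triangle_half_r[of "(f ^^ n) a" a e b] by simp
  qed
  then have "dist a b \<le> 0"
    by (meson dense_ge less_le_not_le linorder_not_le order_less_irrefl)
  then show "a = b" by simp
qed

section \<open>Rotations as small perturbations\<close>

lift_definition circle_rotate :: "real \<Rightarrow> circle \<Rightarrow> circle" is "\<lambda>s x. x + s"
  by (simp add: int_cong_def)

lemma circle_rotate_of: "circle_rotate s (circle_of x) = circle_of (x + s)"
  by transfer (simp add: int_cong_def)

lemma circle_lift_rotate:
  assumes "circle_lift f F"
  shows "circle_lift (circle_rotate s \<circ> f) (\<lambda>x. F x + s)"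
  using assms unfolding circle_lift_def
  by (auto intro!: continuous_intros simp: circle_rotate_of[symmetric])

lemma has_real_derivative_add_const_iff:
  "((\<lambda>x. F x + s) has_real_derivative D) (at x) \<longleftrightarrow> (F has_real_derivative D) (at x)"
proof
  assume "((\<lambda>x. F x + s) has_real_derivative D) (at x)"
  then have "((\<lambda>x. F x + s - s) has_real_derivative D - 0) (at x)"
    by (intro DERIV_diff DERIV_const)
  then show "(F has_real_derivative D) (at x)" by simp
qed (auto intro!: derivative_eq_intros)

text \<open>Both sides choose from the same predicate, so they agree even at points without a
  derivative.\<close>

lemma deriv_add_const: "deriv (\<lambda>x. F x + s :: real) = deriv F"
  by (simp add: deriv_def fun_eq_iff has_real_derivative_add_const_iff)

text \<open>Adding \<open>s\<close> to a lift changes only the derivative of order 0, so a small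
  \<open>s\<close> is a small perturbation for every \<open>r\<close>.\<close>

lemma C_close_rotate:
  assumes F: "circle_lift f F" "C_class r F" and "\<bar>s\<bar> < e"
  shows "C_close r e f (circle_rotate s \<circ> f)"
proof -
  have deriv_pow: "(deriv ^^ k) (\<lambda>x. F x + s) = (if k = 0 then (\<lambda>x. F x + s) else (deriv ^^ k) F)" for k
    by (cases k) (simp_all add: funpow_Suc_right deriv_add_const del: funpow.simps)
  have "C_class r (\<lambda>x. F x + s)"
    using F(2) unfolding C_class_def deriv_pow
    by (auto intro!: continuous_intros differentiable_add differentiable_const)
  moreover have "\<forall>k\<le>r. \<forall>x. \<bar>(deriv ^^ k) F x - (deriv ^^ k) (\<lambda>x. F x + s) x\<bar> < e"
    using assms(3) by (auto simp: deriv_pow)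
  ultimately show ?thesis
    unfolding C_close_def using F circle_lift_rotate[OF F(1), of s] by blast
qed

text \<open>A closing lemma: rotations \<open>F + s\<close> with small \<open>s\<close> make a recurrent point of \<open>F\<close> periodic.\<close>

lemma not_robustly_transitive_if_degree_1:
  assumes F: "circle_lift f F" "strict_mono F" and degree: "circle_degree f = 1"
  shows "\<not> robustly_transitive r f"
proof
  assume "robustly_transitive r f"
  then obtain e G where e: "e > 0" "\<And>g. C_close r e f g \<Longrightarrow> transitive g"
    and G: "circle_lift f G" "C_class r G"
    unfolding robustly_transitive_def circle_C_class_def by blast
  obtain m :: int where "\<And>x. G x = F x + of_int m"
    using circle_lift_unique[OF F(1) G(1)] by blast
  then have G_mono: "strict_mono G" using F(2) by (simp add: strict_mono_def)
  define t where "t = e / 2"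
  have t: "0 < t" "t < e" using e(1) by (auto simp: t_def)
  have trans: "transitive (circle_rotate s \<circ> f)" if "\<bar>s\<bar> \<le> t" for s
    using that t by (intro e(2) C_close_rotate[OF G]) auto
  define P where "P n s x = ((\<lambda>x. G x + s) ^^ n) x" for n s x
  have P_Suc: "P (Suc n) s x = G (P n s x) + s" for n s x
    by (simp add: P_def)
  have P_0: "P n 0 x = (G ^^ n) x" for n x
    by (simp add: P_def)
  have "transitive f"
    using trans[of 0] t circle_rotate_of[of 0] circle_of_surj
    by (metis (no_types, lifting) abs_zero add_0_right comp_apply ext less_le)
  then obtain x where x: "\<And>u v N. u < v \<Longrightarrow>
      \<exists>n\<ge>N. \<exists>j::int. u < (G ^^ n) x + of_int j \<and> (G ^^ n) x + of_int j < v"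
    using transitive_visits_interval[OF _ G(1)] by blast
  \<comment> \<open>Up to an integer, \<open>x\<close> returns less than \<open>t\<close> to its
    left. Rotating by \<open>t\<close> pushes the return to \<open>x\<close> or beyond, so by
    continuity some \<open>s\<close> in \<open>[0, t]\<close> closes the orbit exactly.\<close>
  obtain n and j :: int where n: "n \<ge> 1"
    and j: "x - t < (G ^^ n) x + of_int j" "(G ^^ n) x + of_int j < x"
    using x[of "x - t" x 1] t by auto
  have P_ge: "(G ^^ k) x \<le> P k t x" for k
  proof (induction k)
    case 0
    show ?case by (simp add: P_def)
  next
    case (Suc k)
    then have "G ((G ^^ k) x) \<le> G (P k t x)"
      using G_mono by (simp add: strict_mono_less_eq)
    then show ?case using t by (simp add: P_Suc)
  qed
  have "(G ^^ n) x + t \<le> P n t x"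
    using n P_ge[of "n - 1"] G_mono
    by (cases n) (auto simp: P_Suc strict_mono_less_eq)
  then have above: "x - of_int j \<le> P n t x" using j by simp
  have "isCont (\<lambda>s. P k s x) s" for k s
  proof (induction k)
    case 0
    show ?case by (simp add: P_def)
  next
    case (Suc k)
    have "isCont G y" for y
      using circle_lift_continuous[OF G(1)] by (simp add: continuous_on_eq_continuous_at)
    with Suc show ?case
      unfolding P_Suc by (intro continuous_intros isCont_o2[OF Suc])
  qed
  then have "continuous_on {0..t} (\<lambda>s. P n s x)"
    by (simp add: continuous_at_imp_continuous_on)
  then obtain s where s: "0 \<le> s" "s \<le> t" "P n s x = x - of_int j"
    using IVT'[of "\<lambda>s. P n s x" 0 "x - of_int j" t] above j t by (auto simp: P_0)
  let ?g = "circle_rotate s \<circ> f"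
  have lift: "circle_lift ?g (\<lambda>x. G x + s)"
    using G(1) by (rule circle_lift_rotate)
  \<comment> \<open>In degree 1 the iterates commute with translation by 1, so \<open>x + 1\<close>
    is periodic along with \<open>x\<close>, and \<open>[x, x + 1]\<close> is a trapping
    interval.\<close>
  have "G (y + 1) = G y + 1" for y
    using circle_degree_lift[OF G(1)] degree by simp
  then have "P k s (y + 1) = P k s y + 1" for k y
    by (induction k) (simp_all add: P_Suc, simp add: P_def)
  moreover have "mono (\<lambda>x. G x + s)"
    using G_mono by (simp add: mono_def strict_mono_less_eq)
  ultimately have "\<not> transitive ?g"
    using s(3) n
    by (intro not_transitive_if_trapping_interval[OF lift, of n x "x + 1" "- j"])
      (auto simp: P_def)
  with trans[of s] s show False by simp
qed

section \<open>Expansivity\<close>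

text \<open>Suppose all images of \<open>[u, v]\<close> stay shorter than 1. A dense orbit visits
  \<open>(u, v)\<close> twice, which singles out an integer translate \<open>\<Phi>\<close> of an
  iterate of \<open>F\<close>. As its degree \<open>D\<close> is at least 2, the images of
  \<open>[u, v]\<close> under the powers of \<open>\<Phi>\<close> stay bounded, and their hull is a
  trapping interval.\<close>

lemma expansive_if_transitive:
  fixes F :: "real \<Rightarrow> real"
  assumes F: "circle_lift f F" "strict_mono F" and degree: "circle_degree f \<ge> 2"
    and trans: "transitive f"
    and close: "\<And>k. \<bar>(F ^^ k) x - (F ^^ k) y\<bar> < 1"
  shows "x = y"
proof -
  have wlog: False if "u < v" and uv: "\<And>k. (F ^^ k) v - (F ^^ k) u < 1" for u v
  proof -
    obtain p where p: "\<And>u v N. u < v \<Longrightarrow>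
        \<exists>n\<ge>N. \<exists>j::int. u < (F ^^ n) p + of_int j \<and> (F ^^ n) p + of_int j < v"
      using transitive_visits_interval[OF trans F(1)] by blast
    obtain m and i :: int where m: "u < (F ^^ m) p + of_int i" "(F ^^ m) p + of_int i < v"
      using p[OF \<open>u < v\<close>, of 0] by auto
    obtain l and j :: int where l: "l \<ge> m + 1" "u < (F ^^ l) p + of_int j" "(F ^^ l) p + of_int j < v"
      using p[OF \<open>u < v\<close>, of "m + 1"] by auto
    define n where "n = l - m"
    have n: "n \<ge> 1" "l = n + m" using l(1) by (auto simp: n_def)
    \<comment> \<open>\<open>w\<close> is an orbit point in \<open>(u, v)\<close> whose
      \<open>n\<close>-th image projects to another such point; \<open>z\<close> is the integer that
      moves this image back into \<open>(u, v)\<close>.\<close>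
    define w where "w = (F ^^ m) p + of_int i"
    have "circle_of ((F ^^ n) w) = circle_of ((F ^^ l) p + of_int j)"
      unfolding w_def n(2) circle_of_add_int funpow_add o_apply
      by (intro funpow_shift[OF F(1)] circle_of_add_int)
    then obtain z :: int where z: "(F ^^ n) w = (F ^^ l) p + of_int j + of_int z"
      by (rule circle_of_eqE)
    define \<Phi> where "\<Phi> = (\<lambda>x. (F ^^ n) x - of_int z)"
    have w: "u < w" "w < v" "u < \<Phi> w" "\<Phi> w < v"
      using m l z by (auto simp: w_def \<Phi>_def)
    have \<Phi>_mono: "strict_mono \<Phi>"
      using strict_mono_funpow[OF F(2), of n] by (simp add: \<Phi>_def strict_mono_def)
    define D where "D = circle_degree f ^ n"
    have D: "D \<ge> 2"
      using self_le_power[of "circle_degree f" n] degree n(1) by (simp add: D_def)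
    have shift: "(F ^^ k) (y + of_int c) = (F ^^ k) y + of_int (circle_degree f ^ k * c)" for k y c
    proof (induction k)
      case (Suc k)
      then show ?case
        using circle_degree_lift_int[OF F(1), of "(F ^^ k) y" "circle_degree f ^ k * c"]
        by (simp add: mult.assoc)
    qed simp
    have \<Phi>_shift: "\<Phi> (y + of_int c) = \<Phi> y + of_int (D * c)" for y c
      by (simp add: \<Phi>_def shift D_def)
    have \<Phi>_pow: "\<exists>c. \<forall>y. (\<Phi> ^^ k) y = (F ^^ (n * k)) y - of_int c" for k
    proof (induction k)
      case 0
      show ?case by (intro exI[of _ 0]) simp
    next
      case (Suc k)
      then obtain c where c: "\<And>y. (\<Phi> ^^ k) y = (F ^^ (n * k)) y - of_int c" by blast
      have "(\<Phi> ^^ Suc k) y = (F ^^ (n * Suc k)) y - of_int (z + D * c)" for y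
      proof -
        have "(\<Phi> ^^ Suc k) y = \<Phi> ((F ^^ (n * k)) y) - of_int (D * c)"
          using \<Phi>_shift[of "(F ^^ (n * k)) y" "- c"] by (simp add: c)
        also have "\<Phi> ((F ^^ (n * k)) y) = (F ^^ (n * Suc k)) y - of_int z"
          by (simp add: \<Phi>_def funpow_add)
        finally show ?thesis by simp
      qed
      then show ?case by blast
    qed
    have \<Phi>_close: "(\<Phi> ^^ k) v - (\<Phi> ^^ k) u < 1" for k
      using \<Phi>_pow[of k] uv[of "n * k"] by auto
    define a b where "a k = (\<Phi> ^^ k) u" and "b k = (\<Phi> ^^ k) v" for k
    have ab: "a k < b k" "b k - a k < 1" for k
      using \<Phi>_close[of k] \<open>u < v\<close> strict_mono_funpow[OF \<Phi>_mono, of k]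
      by (auto simp: a_def b_def strict_mono_def)
    have a_Suc: "a (Suc k) = \<Phi> (a k)" and b_Suc: "b (Suc k) = \<Phi> (b k)" for k
      by (auto simp: a_def b_def)
    \<comment> \<open>The intervals \<open>(a k, b k)\<close> and
      \<open>(a (Suc k), b (Suc k))\<close> share the point \<open>(\<Phi> ^^ k) (\<Phi> w)\<close>,
      and both are shorter than 1.\<close>
    have jump: "\<bar>\<Phi> (a k) - a k\<bar> < 1" for k
    proof -
      have mono_k: "strict_mono (\<Phi> ^^ k)" by (rule strict_mono_funpow[OF \<Phi>_mono])
      have "(\<Phi> ^^ k) (\<Phi> w) < b k" "a k < (\<Phi> ^^ k) (\<Phi> w)"
        using w mono_k by (auto simp: a_def b_def strict_mono_def)
      moreover have "a (Suc k) < (\<Phi> ^^ k) (\<Phi> w)" "(\<Phi> ^^ k) (\<Phi> w) < b (Suc k)"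
        using w mono_k \<Phi>_mono by (auto simp: a_def b_def strict_mono_def funpow_Suc_right simp del: funpow.simps)
      ultimately show ?thesis
        using ab[of k] ab[of "Suc k"] by (simp add: a_Suc abs_less_iff)
    qed
    define B where "B = \<bar>\<Phi> 0\<bar> + \<bar>\<Phi> 1\<bar> + 3 + of_int D"
    \<comment> \<open>With \<open>c\<close> the integer part of \<open>a k\<close>, the displacement
      under \<open>\<Phi>\<close> is \<open>(D - 1) * c\<close> up to a bounded error. As it is
      smaller than 1 and \<open>D \<ge> 2\<close>, \<open>c\<close> is bounded.\<close>
    have a_bound: "\<bar>a k\<bar> \<le> B" for k
    proof -
      define c where "c = \<lfloor>a k\<rfloor>"
      define y where "y = a k - of_int c"
      have y: "0 \<le> y" "y < 1" "a k = y + of_int c"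
        by (auto simp: y_def c_def) linarith
      have "\<Phi> 0 \<le> \<Phi> y" "\<Phi> y \<le> \<Phi> 1"
        using y \<Phi>_mono by (auto simp: strict_mono_less_eq)
      moreover have "\<bar>\<Phi> y + of_int ((D - 1) * c) - y\<bar> < 1"
        using jump[of k] by (simp add: y(3) \<Phi>_shift algebra_simps)
      ultimately have "\<bar>real_of_int ((D - 1) * c)\<bar> \<le> \<bar>\<Phi> 0\<bar> + \<bar>\<Phi> 1\<bar> + 2"
        using y(1,2) by linarith
      moreover have "\<bar>c\<bar> \<le> \<bar>(D - 1) * c\<bar>"
        using D mult_right_mono[of 1 "D - 1" "\<bar>c\<bar>"] by (simp add: abs_mult)
      then have "\<bar>real_of_int c\<bar> \<le> \<bar>real_of_int ((D - 1) * c)\<bar>"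
        by linarith
      ultimately show ?thesis
        using y D unfolding B_def by linarith
    qed
    have b_bound: "\<bar>b k\<bar> \<le> B + 1" for k
      using a_bound[of k] ab[of k] by linarith
    define u' v' where "u' = (INF k. a k)" and "v' = (SUP k. b k)"
    have bdd: "bdd_below (range a)" "bdd_above (range b)"
      using a_bound b_bound
      by (auto intro!: bdd_belowI2[of _ "- B"] bdd_aboveI2[of _ _ "B + 1"] simp: abs_le_iff)
         (smt (verit))+
    have u'_le: "u' \<le> a k" and v'_ge: "b k \<le> v'" for k
      unfolding u'_def v'_def using bdd by (auto intro: cINF_lower cSUP_upper)
    have cont: "isCont \<Phi> t" for t
      unfolding \<Phi>_def using circle_lift_continuous[OF circle_lift_funpow[OF F(1), of n]]
      by (auto intro!: continuous_intros simp: continuous_on_eq_continuous_at)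
    have "u' \<le> \<Phi> u'"
    proof (rule ccontr)
      assume "\<not> u' \<le> \<Phi> u'"
      then obtain d where d: "d > 0" "\<And>t. \<bar>t - u'\<bar> < d \<Longrightarrow> \<bar>\<Phi> t - \<Phi> u'\<bar> < u' - \<Phi> u'"
        using cont[of u'] unfolding continuous_at_eps_delta dist_real_def
        by (metis diff_gt_0_iff_gt not_le)
      obtain k where "a k < u' + d"
        using cINF_less_iff[OF _ bdd(1), of "u' + d"] d(1) by (auto simp: u'_def)
      then have "\<Phi> (a k) < u'" using d(2)[of "a k"] u'_le[of k] by auto
      then show False using u'_le[of "Suc k"] by (simp add: a_Suc)
    qed
    moreover have "\<Phi> v' \<le> v'"
    proof (rule ccontr)
      assume "\<not> \<Phi> v' \<le> v'"
      then obtain d where d: "d > 0" "\<And>t. \<bar>t - v'\<bar> < d \<Longrightarrow> \<bar>\<Phi> t - \<Phi> v'\<bar> < \<Phi> v' - v'"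
        using cont[of v'] unfolding continuous_at_eps_delta dist_real_def
        by (metis diff_gt_0_iff_gt not_le)
      obtain k where "v' - d < b k"
        using less_cSUP_iff[OF _ bdd(2), of "v' - d"] d(1) by (auto simp: v'_def)
      then have "\<Phi> (b k) > v'" using d(2)[of "b k"] v'_ge[of k] by auto
      then show False using v'_ge[of "Suc k"] by (simp add: b_Suc)
    qed
    moreover have "u' < v'"
      using u'_le[of 0] v'_ge[of 0] ab(1)[of 0] by linarith
    ultimately have "\<not> transitive f"
      using strict_mono_mono[OF F(2)] n(1)
      by (intro not_transitive_if_trapping_interval[OF F(1), of n u' v' z]) (auto simp: \<Phi>_def)
    with trans show False by simp
  qed
  show ?thesis
  proof (rule ccontr)
    assume "x \<noteq> y"
    then consider "x < y" | "y < x" by linarith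
    then show False
      using wlog close by cases (metis abs_less_iff minus_diff_eq)+
  qed
qed

section \<open>Critical points\<close>

lemma C_class_2_derivs:
  assumes "C_class 2 F"
  obtains F' F'' where "\<And>x. (F has_real_derivative F' x) (at x)"
    "\<And>x. (F' has_real_derivative F'' x) (at x)" "continuous_on UNIV F''"
proof
  have diff: "(deriv ^^ k) F differentiable (at x)" if "k < 2" for k x
    using assms that by (simp add: C_class_def)
  show "(F has_real_derivative deriv F x) (at x)" for x
    using diff[of 0 x] by (simp add: DERIV_deriv_iff_real_differentiable)
  show "(deriv F has_real_derivative deriv (deriv F) x) (at x)" for x
    using diff[of 1 x] by (simp add: DERIV_deriv_iff_real_differentiable)
  show "continuous_on UNIV (deriv (deriv F))"
    using assms by (simp add: C_class_def numeral_2_eq_2)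
qed

text \<open>A bound \<open>M\<close> on \<open>F''\<close> near \<open>c\<close> gives
  \<open>\<bar>F' y\<bar> \<le> M * \<bar>x - c\<bar>\<close> between \<open>c\<close> and
  \<open>x\<close>; a second mean value estimate gives the square.\<close>

lemma quadratic_bound_at_critical_point:
  fixes F :: "real \<Rightarrow> real"
  assumes D: "\<And>x. (F has_real_derivative F' x) (at x)"
    and D2: "\<And>x. (F' has_real_derivative F'' x) (at x)" and cont: "continuous_on UNIV F''"
    and crit: "F' c = 0"
  obtains M where "M > 0" "\<And>x. \<bar>x - c\<bar> \<le> 1 \<Longrightarrow> \<bar>F x - F c\<bar> \<le> M * \<bar>x - c\<bar> ^ 2"
proof -
  have "compact (F'' ` {c - 1..c + 1})"
    using cont by (intro compact_continuous_image) (auto intro: continuous_on_subset)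
  then obtain M where M: "M > 0" "\<And>x. x \<in> {c - 1..c + 1} \<Longrightarrow> \<bar>F'' x\<bar> \<le> M"
    using bounded_pos compact_imp_bounded by (metis imageI real_norm_def)
  have "\<bar>F x - F c\<bar> \<le> M * \<bar>x - c\<bar> ^ 2" if x: "\<bar>x - c\<bar> \<le> 1" for x
  proof -
    have F'_le: "\<bar>F' y\<bar> \<le> M * \<bar>x - c\<bar>" if y: "y \<in> cball c \<bar>x - c\<bar>" for y
    proof -
      have "norm (F' y - F' c) \<le> M * norm (y - c)"
      proof (rule field_differentiable_bound[of "cball c \<bar>x - c\<bar>" F' F''])
        show "norm (F'' z) \<le> M" if "z \<in> cball c \<bar>x - c\<bar>" for z
          using that x by (intro M(2)[of z, folded real_norm_def]) (simp add: dist_real_def, linarith)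
      qed (use y D2 in \<open>auto intro: has_field_derivative_at_within\<close>)
      also have "\<dots> \<le> M * \<bar>x - c\<bar>"
        using M(1) y by (intro mult_left_mono) (auto simp: dist_real_def)
      finally show ?thesis by (simp add: crit)
    qed
    have "norm (F x - F c) \<le> (M * \<bar>x - c\<bar>) * norm (x - c)"
      using D F'_le
      by (intro field_differentiable_bound[of "cball c \<bar>x - c\<bar>" F F'])
        (auto simp: dist_real_def intro: has_field_derivative_at_within)
    then show ?thesis by (simp add: power2_eq_square mult.assoc)
  qed
  with M(1) show thesis by (rule that)
qed

lemma powr_eventually_less:
  assumes "K \<ge> 0" "\<beta> > 1"
  shows "\<forall>\<^sub>F t in at_right (0::real). K * t powr \<beta> < t"
proof -
  have "((\<lambda>t::real. K * t powr (\<beta> - 1)) \<longlongrightarrow> K * 0) (at_right 0)"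
    using assms(2) by (intro tendsto_intros tendsto_zero_powrI) (auto simp: eventually_at_filter)
  then have "\<forall>\<^sub>F t in at_right 0. K * t powr (\<beta> - 1) < 1"
    by (rule order_tendstoD) simp
  then show ?thesis
    using eventually_at_right_less[of "0::real"]
  proof eventually_elim
    case (elim t)
    have "K * t powr \<beta> = K * t powr (\<beta> - 1) * t"
      using elim by (simp add: powr_diff)
    also have "\<dots> < 1 * t" using elim by (intro mult_strict_right_mono) auto
    finally show ?case by simp
  qed
qed

lemma powr_eventually_less_const:
  assumes "\<beta> > 0" "e > 0"
  shows "\<forall>\<^sub>F t in at_right (0::real). K * t powr \<beta> < e"
proof -
  have "((\<lambda>t::real. K * t powr \<beta>) \<longlongrightarrow> K * 0) (at_right 0)"
    using assms(1) by (intro tendsto_intros tendsto_zero_powrI) (auto simp: eventually_at_filter)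
  then show ?thesis
    using assms(2) by (intro order_tendstoD(2)) auto
qed

text \<open>A pseudo-orbit may jump from \<open>c\<close> to any point \<open>z\<close> within \<open>t\<close> of \<open>F c\<close>, but because \<open>F\<close> is
  quadratic at \<open>c\<close>, the orbit that shadows it passes much closer to \<open>F c\<close>, as \<open>2 * \<alpha> > 1\<close>. So the orbit
  of \<open>z\<close> is close to that of a point much closer to \<open>F c\<close>; iterating this, to that of \<open>F c\<close>.\<close>

lemma critical_value_stable:
  fixes F :: "real \<Rightarrow> real"
  assumes F: "circle_lift f F" and quad: "M > 0" "\<And>x. \<bar>x - c\<bar> \<le> 1 \<Longrightarrow> \<bar>F x - F c\<bar> \<le> M * \<bar>x - c\<bar> ^ 2"
    and \<alpha>: "1 / 2 < \<alpha>" and shadow: "Holder_shadowing \<alpha> f" and "e > 0"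
  shows "\<exists>d>0. \<forall>p k. dist p (circle_of (F c)) < d \<longrightarrow> dist ((f ^^ k) p) ((f ^^ k) (circle_of (F c))) < e"
proof -
  obtain C where C: "C > 0" "\<And>\<epsilon> X. \<epsilon> > 0 \<Longrightarrow> pseudo_orbit f \<epsilon> X \<Longrightarrow> \<exists>x. shadowed_by f (C * \<epsilon> powr \<alpha>) X x"
    using shadow unfolding Holder_shadowing_def by blast
  \<comment> \<open>The first condition, where \<open>2 * \<alpha> > 1\<close> enters, brings the
    new point within \<open>t / 4\<close>; the second keeps the shadowing point where the quadratic
    bound holds; the third bounds the total error.\<close>
  have "\<forall>\<^sub>F t in at_right (0::real). 4 * M * C\<^sup>2 * t powr (2 * \<alpha>) < t \<and> C * t powr \<alpha> < 1
      \<and> 2 * C * t powr \<alpha> < e / 2"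
    using \<alpha> C quad \<open>e > 0\<close>
    by (intro eventually_conj powr_eventually_less powr_eventually_less_const) auto
  then obtain T where "T > 0" and T: "\<And>t. 0 < t \<Longrightarrow> t < T \<Longrightarrow> 4 * M * C\<^sup>2 * t powr (2 * \<alpha>) < t"
      "\<And>t. 0 < t \<Longrightarrow> t < T \<Longrightarrow> C * t powr \<alpha> < 1" "\<And>t. 0 < t \<Longrightarrow> t < T \<Longrightarrow> 2 * C * t powr \<alpha> < e / 2"
    unfolding eventually_at_right_field by blast
  have step: "\<exists>y. \<bar>y - F c\<bar> < t / 4 \<and> (\<forall>k. dist ((f ^^ k) (circle_of y)) ((f ^^ k) (circle_of z)) < C * t powr \<alpha>)"
    if t: "0 < t" "t < T" and z: "\<bar>z - F c\<bar> < t" for t z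
  proof -
    \<comment> \<open>The only jump is the first, from \<open>F c\<close> to \<open>z\<close>; the
      index \<open>k - 1\<close> reflects that the orbit of \<open>z\<close> starts at time
      1.\<close>
    define X where "X = (\<lambda>k. if k = 0 then circle_of c else (f ^^ (k - 1)) (circle_of z))"
    have "dist (f (X k)) (X (Suc k)) < t" for k
    proof (cases k)
      case 0
      then show ?thesis
        using z dist_circle_of_le[of "F c" z] by (simp add: X_def circle_lift_apply[OF F])
    next
      case (Suc j)
      then show ?thesis using t by (simp add: X_def)
    qed
    then obtain p where p: "\<And>n. dist ((f ^^ n) p) (X n) < C * t powr \<alpha>"
      using C(2)[OF t(1), of X] unfolding pseudo_orbit_def shadowed_by_def by blast
    then have "dist p (circle_of c) < C * t powr \<alpha>"
      by (metis X_def funpow_0)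
    then obtain x where x: "circle_of x = p" "\<bar>x - c\<bar> < C * t powr \<alpha>"
      by (rule dist_circle_representative)
    have "\<bar>F x - F c\<bar> \<le> M * \<bar>x - c\<bar> ^ 2"
      using x T(2)[OF t] by (intro quad) auto
    also have "\<dots> \<le> M * (C * t powr \<alpha>) ^ 2"
      using x quad(1) by (intro mult_left_mono power_mono) auto
    also have "\<dots> = M * C\<^sup>2 * t powr (2 * \<alpha>)"
      using t by (simp add: power_mult_distrib powr_power mult.commute)
    also have "\<dots> < t / 4" using T(1)[OF t] by simp
    finally have "\<bar>F x - F c\<bar> < t / 4" .
    moreover have "dist ((f ^^ k) (circle_of (F x))) ((f ^^ k) (circle_of z)) < C * t powr \<alpha>" for k
      using p[of "Suc k"] unfolding X_def
      by (simp add: funpow_swap1 x(1)[symmetric] circle_lift_apply[OF F])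
    ultimately show ?thesis by blast
  qed
  \<comment> \<open>The radius shrinks by 4 per step, so the error shrinks by
    \<open>4 powr \<alpha> \<ge> 2\<close>. The bound is a partial sum of the geometric series with
    first term \<open>C * t powr \<alpha>\<close> and ratio \<open>1 / 2\<close>.\<close>
  have chain: "\<exists>y. \<bar>y - F c\<bar> < t / 4 ^ j \<and>
      (\<forall>k. dist ((f ^^ k) (circle_of y)) ((f ^^ k) (circle_of z)) \<le> 2 * C * t powr \<alpha> * (1 - (1 / 2) ^ j))"
    if t: "0 < t" "t < T" and z: "\<bar>z - F c\<bar> < t" for t z j
  proof (induction j)
    case 0
    show ?case using z by (intro exI[of _ z]) simp
  next
    case (Suc j)
    then obtain y where y: "\<bar>y - F c\<bar> < t / 4 ^ j"
      "\<And>k. dist ((f ^^ k) (circle_of y)) ((f ^^ k) (circle_of z)) \<le> 2 * C * t powr \<alpha> * (1 - (1 / 2) ^ j)"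
      by blast
    have "t / 4 ^ j \<le> t" using t by (simp add: divide_le_eq)
    then have "0 < t / 4 ^ j" "t / 4 ^ j < T" using t by auto
    from step[OF this y(1)] obtain y' where y': "\<bar>y' - F c\<bar> < t / 4 ^ j / 4"
      "\<And>k. dist ((f ^^ k) (circle_of y')) ((f ^^ k) (circle_of y)) < C * (t / 4 ^ j) powr \<alpha>"
      by blast
    have "(4 ^ j) powr (1 / 2) = (2 ^ j :: real)"
      by (simp add: powr_half_sqrt real_sqrt_power)
    then have "2 ^ j \<le> (4 ^ j :: real) powr \<alpha>"
      using powr_mono[of "1 / 2" \<alpha> "4 ^ j"] \<alpha> by simp
    then have "C * (t powr \<alpha> / (4 ^ j) powr \<alpha>) \<le> C * (t powr \<alpha> / 2 ^ j)"
      using C(1) by (intro mult_left_mono divide_left_mono) auto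
    then have "C * (t / 4 ^ j) powr \<alpha> \<le> C * t powr \<alpha> * (1 / 2) ^ j"
      using t by (simp add: powr_divide power_one_over)
    then have "dist ((f ^^ k) (circle_of y')) ((f ^^ k) (circle_of z))
        \<le> C * t powr \<alpha> * (1 / 2) ^ j + 2 * C * t powr \<alpha> * (1 - (1 / 2) ^ j)" for k
      using y(2)[of k] y'(2)[of k]
        dist_triangle[of "(f ^^ k) (circle_of y')" "(f ^^ k) (circle_of z)" "(f ^^ k) (circle_of y)"]
      by linarith
    then show ?case
      using y'(1) by (intro exI[of _ y']) (simp add: algebra_simps)
  qed
  define t where "t = T / 2"
  have t: "0 < t" "t < T" using \<open>T > 0\<close> by (auto simp: t_def)
  have "dist ((f ^^ k) p) ((f ^^ k) (circle_of (F c))) < e" if p: "dist p (circle_of (F c)) < t" for p k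
  proof -
    obtain z where z: "circle_of z = p" "\<bar>z - F c\<bar> < t"
      using p by (rule dist_circle_representative)
    from chain[OF t z(2)] obtain Y where Y: "\<And>j. \<bar>Y j - F c\<bar> < t / 4 ^ j"
      "\<And>j. dist ((f ^^ k) (circle_of (Y j))) ((f ^^ k) p) \<le> 2 * C * t powr \<alpha> * (1 - (1 / 2) ^ j)"
      unfolding z(1) by metis
    have "(\<lambda>j. t / 4 ^ j) \<longlonglongrightarrow> 0" by (intro LIMSEQ_divide_realpow_zero) simp
    then have "(\<lambda>j. Y j - F c) \<longlonglongrightarrow> 0"
      by (rule Lim_null_comparison[rotated]) (simp add: less_imp_le Y(1))
    then have "Y \<longlonglongrightarrow> F c" by (rule LIM_zero_cancel)
    then have "(\<lambda>j. dist ((f ^^ k) (circle_of (Y j))) ((f ^^ k) p))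
        \<longlonglongrightarrow> dist ((f ^^ k) (circle_of (F c))) ((f ^^ k) p)"
      by (intro tendsto_intros isCont_tendsto_compose[OF circle_lift_isCont[OF circle_lift_funpow[OF F]]]
          isCont_tendsto_compose[OF isCont_circle_of])
    moreover have "2 * C * t powr \<alpha> * (1 - (1 / 2) ^ j) \<le> 2 * C * t powr \<alpha>" for j :: nat
      using C(1) by (intro mult_left_le) (auto simp: power_le_one)
    ultimately have "dist ((f ^^ k) (circle_of (F c))) ((f ^^ k) p) \<le> 2 * C * t powr \<alpha>"
      using Y(2) by (meson LIMSEQ_le_const2 order_trans)
    then show ?thesis using T(3)[OF t] \<open>e > 0\<close> by (simp add: dist_commute)
  qed
  with t(1) show ?thesis by blast
qed

text \<open>A continuous injective lift is monotone, and positive degree makes it increasing. In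
  degree 2 or more it would take the value \<open>F 0 + 1\<close> strictly between 0 and 1, giving a
  second preimage of \<open>circle_of (F 0)\<close>.\<close>

lemma circle_lift_inj:
  assumes F: "circle_lift f F" and degree: "circle_degree f > 0" and "inj f"
  shows "strict_mono F" "circle_degree f = 1"
proof -
  have "inj F"
  proof (rule injI)
    fix x y assume "F x = F y"
    then have "circle_of x = circle_of y"
      using \<open>inj f\<close> circle_lift_apply[OF F] by (metis injD)
    then obtain k where "x = y + of_int k" by (rule circle_of_eqE)
    then show "x = y"
      using circle_degree_lift_int[OF F, of y k] \<open>F x = F y\<close> degree by simp
  qed
  then have "strict_mono_on UNIV F \<or> strict_antimono_on UNIV F"
    using injective_eq_monotone_map[of UNIV F] circle_lift_continuous[OF F] by simp
  moreover have "F 1 > F 0"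
    using circle_degree_lift[OF F, of 0] degree by simp
  ultimately show "strict_mono F"
    by (auto dest: monotone_onD[of UNIV "(<)" "(>)" F 0 1])
  have "False" if "circle_degree f \<ge> 2"
  proof -
    have "F 0 \<le> F 0 + 1" "F 0 + 1 \<le> F 1"
      using circle_degree_lift[OF F, of 0] that by auto
    then obtain y where y: "0 \<le> y" "y \<le> 1" "F y = F 0 + 1"
      using IVT'[of F 0 "F 0 + 1" 1]
        continuous_on_subset[OF circle_lift_continuous[OF F], of "{0..1}"] by auto
    have "circle_of (F y) = circle_of (F 0)"
      using circle_of_add_int[of "F 0" 1] by (simp add: y(3))
    then have "circle_of y = circle_of 0"
      using \<open>inj f\<close> circle_lift_apply[OF F] by (metis injD)
    then obtain k where "y = of_int k" by (rule circle_of_eqE) auto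
    with y have "y = 0 \<or> y = 1" by auto
    then show False
      using y(3) circle_degree_lift[OF F, of 0] that by auto
  qed
  then show "circle_degree f = 1" using degree by force
qed

section \<open>Expansion\<close>

lemma periodic_bounded:
  fixes h :: "real \<Rightarrow> real"
  assumes cont: "continuous_on UNIV h" and periodic: "\<And>x. h (x + 1) = h x"
  obtains B where "B > 0" "\<And>x. \<bar>h x\<bar> \<le> B"
proof -
  have "compact (h ` {0..1})"
    using cont by (intro compact_continuous_image) (auto intro: continuous_on_subset)
  then obtain B where B: "B > 0" "\<And>x. x \<in> {0..1} \<Longrightarrow> \<bar>h x\<bar> \<le> B"
    using bounded_pos compact_imp_bounded by (metis imageI real_norm_def)
  have shift: "h (x + of_int k) = h x" for x k
  proof (induction k rule: int_induct[where k = 0])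
    case (step1 k)
    then show ?case using periodic[of "x + of_int k"] by (simp add: add.assoc)
  next
    case (step2 k)
    then show ?case using periodic[of "x + of_int (k - 1)"] by simp
  qed simp
  have "\<bar>h x\<bar> \<le> B" for x
    using B(2)[of "frac x"] shift[of "frac x" "\<lfloor>x\<rfloor>"] frac_ge_0[of x] frac_lt_1[of x]
    by (simp add: frac_def)
  with B(1) show thesis by (rule that)
qed

lemma has_real_derivative_funpow:
  fixes F :: "real \<Rightarrow> real"
  assumes "\<And>x. (F has_real_derivative F' x) (at x)"
  shows "((F ^^ n) has_real_derivative (\<Prod>i<n. F' ((F ^^ i) x))) (at x)"
proof (induction n)
  case 0
  show ?case by (simp add: id_def)
next
  case (Suc n)
  have "((\<lambda>y. F ((F ^^ n) y)) has_real_derivative F' ((F ^^ n) x) * (\<Prod>i<n. F' ((F ^^ i) x))) (at x)"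
    by (rule DERIV_chain2[OF assms Suc])
  then show ?case by (simp add: comp_def mult.commute)
qed

text \<open>If \<open>(F ^^ n)' x \<le> 2\<close> for \<open>1 \<le> n \<le> N\<close>, take the backward pseudo-orbit \<open>y\<^sub>N = x\<^sub>N\<close>,
  \<open>F y\<^sub>i = y\<^sub>i\<^sub>+\<^sub>1 + s\<close>, where \<open>x\<^sub>i = F\<^sup>i x\<close>. By expansivity only \<open>x\<close> can shadow it, so
  \<open>w\<^sub>i = y\<^sub>i - x\<^sub>i\<close> is smaller than \<open>W = C (2 s)\<^sup>\<alpha>\<close>. On the other hand \<open>F' \<le> (1 + V W) F' x\<^sub>i\<close> between \<open>x\<^sub>i\<close> and
  \<open>y\<^sub>i\<close>, hence \<open>w\<^sub>0 \<ge> s \<Sum>\<^sub>j ((F ^^ j)' x (1 + V W)\<^sup>j)\<^sup>-\<^sup>1 \<ge> s N / (2 e)\<close> when \<open>N V W \<le> 1\<close>. With \<open>N\<close>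
  of order \<open>1 / W\<close> this makes \<open>W\<^sup>2\<close> at least of order \<open>s\<close>, which fails for small \<open>s\<close> as \<open>2 \<alpha> > 1\<close>.\<close>

lemma uniform_growth:
  fixes F :: "real \<Rightarrow> real"
  assumes F: "circle_lift f F" "strict_mono F" "surj F"
    and D: "\<And>x. (F has_real_derivative F' x) (at x)" "\<And>x. 0 < F' x" "\<And>x. F' x \<le> L"
    and V: "V > 0" "\<And>x y. F' y \<le> F' x * (1 + V * \<bar>y - x\<bar>)"
    and expansive: "\<And>x y. (\<And>k. \<bar>(F ^^ k) x - (F ^^ k) y\<bar> < 1) \<Longrightarrow> x = y"
    and \<alpha>: "1 / 2 < \<alpha>" and shadow: "Holder_shadowing \<alpha> f"
  obtains N where "N \<ge> 1" "\<And>x. \<exists>n\<in>{1..N}. 2 < (\<Prod>i<n. F' ((F ^^ i) x))"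
proof -
  obtain C where C: "C > 0" "\<And>\<epsilon> X. \<epsilon> > 0 \<Longrightarrow> pseudo_orbit f \<epsilon> X \<Longrightarrow> \<exists>x. shadowed_by f (C * \<epsilon> powr \<alpha>) X x"
    using shadow unfolding Holder_shadowing_def by blast
  have L: "L > 0" using D(2,3) less_le_trans by blast
  \<comment> \<open>With \<open>W = C * t powr \<alpha>\<close>, the first condition yields the
    final contradiction, the bound by \<open>1 / (2 * V)\<close> makes \<open>N\<close> large
    enough, and the others keep distances between lifts below \<open>1 / 2\<close>.\<close>
  have "\<forall>\<^sub>F t in at_right (0::real). 8 * exp 1 * V * C\<^sup>2 * t powr (2 * \<alpha>) < t
      \<and> C * t powr \<alpha> < 1 / (2 * V) \<and> C * t powr \<alpha> < 1 / 4 \<and> C * t powr \<alpha> < 1 / (4 * L)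
      \<and> t < 1 / 4"
    using \<alpha> C V L
    by (intro eventually_conj powr_eventually_less powr_eventually_less_const
        order_tendstoD(2)[OF tendsto_ident_at]) auto
  then have "\<forall>\<^sub>F t in at_right (0::real). 0 < t \<and> 8 * exp 1 * V * C\<^sup>2 * t powr (2 * \<alpha>) < t
      \<and> C * t powr \<alpha> < 1 / (2 * V) \<and> C * t powr \<alpha> < 1 / 4 \<and> C * t powr \<alpha> < 1 / (4 * L)
      \<and> t < 1 / 4"
    using eventually_at_right_less[of "0::real"] by eventually_elim auto
  then obtain t where t: "0 < t" "8 * exp 1 * V * C\<^sup>2 * t powr (2 * \<alpha>) < t"
      "C * t powr \<alpha> < 1 / (2 * V)" "C * t powr \<alpha> < 1 / 4" "C * t powr \<alpha> < 1 / (4 * L)" "t < 1 / 4"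
    using eventually_happens' trivial_limit_at_right_real by (metis (no_types, lifting))
  define s W where "s = t / 2" and "W = C * t powr \<alpha>"
  have s: "s > 0" "s < t" using t by (auto simp: s_def)
  have W: "W > 0" "W < 1 / 4" "V * W < 1 / 2" "L * W < 1 / 4" "8 * exp 1 * V * W\<^sup>2 < t"
    using t C(1) V(1) L by (auto simp: W_def field_simps power_mult_distrib powr_power)
  \<comment> \<open>This is the longest time with \<open>N * (V * W) \<le> 1\<close>, so that the
    distortion factor \<open>(1 + V * W) ^ N\<close> is at most \<open>exp 1\<close>.\<close>
  define N where "N = nat \<lfloor>1 / (V * W)\<rfloor>"
  have VW: "V * W > 0" using V(1) W(1) by simp
  have N: "real N * (V * W) \<le> 1" "real N \<ge> 1 / (2 * (V * W))" "N \<ge> 1"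
  proof -
    have two: "1 / (V * W) > 2"
      using W(3) VW by (simp add: field_simps)
    then have "0 \<le> \<lfloor>1 / (V * W)\<rfloor>" by linarith
    then have N_real: "real N = of_int \<lfloor>1 / (V * W)\<rfloor>"
      by (simp only: N_def of_nat_nat)
    have "real N \<le> 1 / (V * W)" unfolding N_real by linarith
    then show "real N * (V * W) \<le> 1" using VW by (simp add: field_simps)
    have "real N > 1 / (V * W) - 1" unfolding N_real by linarith
    with two show "real N \<ge> 1 / (2 * (V * W))" "N \<ge> 1" by auto
  qed
  have "\<exists>n\<in>{1..N}. 2 < (\<Prod>i<n. F' ((F ^^ i) x))" for x
  proof (rule ccontr)
    assume "\<not> (\<exists>n\<in>{1..N}. 2 < (\<Prod>i<n. F' ((F ^^ i) x)))"
    then have slow: "(\<Prod>i<n. F' ((F ^^ i) x)) \<le> 2" if "1 \<le> n" "n \<le> N" for n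
      using that by (meson atLeastAtMost_iff not_le)
    define Z where "Z j = ((\<lambda>y. inv F (y + s)) ^^ j) ((F ^^ N) x)" for j
    define Y where "Y k = (if k \<le> N then Z (N - k) else (F ^^ k) x)" for k
    have Y_ge: "Y k = (F ^^ k) x" if "k \<ge> N" for k
      using that by (auto simp: Y_def Z_def)
    have Y_step: "F (Y k) = Y (Suc k) + s" if "k < N" for k
    proof -
      have "N - k = Suc (N - Suc k)" using that by simp
      then show ?thesis
        using that by (simp add: Y_def Z_def surj_f_inv_f[OF F(3)])
    qed
    have Y_jump: "\<bar>F (Y k) - Y (Suc k)\<bar> \<le> s" for k
      using Y_step[of k] Y_ge[of k] Y_ge[of "Suc k"] s by (cases "k < N") auto
    have "pseudo_orbit f t (\<lambda>k. circle_of (Y k))"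
      unfolding pseudo_orbit_def circle_lift_apply[OF F(1)]
      using dist_circle_of_le Y_jump s(2) by (meson le_less_trans)
    then obtain p where p: "\<And>k. dist ((f ^^ k) p) (circle_of (Y k)) < W"
      using C(2)[OF t(1)] unfolding shadowed_by_def W_def by blast
    obtain u where u: "circle_of u = p" "\<bar>u - Y 0\<bar> < W"
      using p[of 0] dist_circle_representative by (metis funpow_0)
    \<comment> \<open>Shadowing controls distances on the circle only. By induction the lifts stay
      less than \<open>1 / 2\<close> apart, where both distances agree.\<close>
    have near: "\<bar>(F ^^ k) u - Y k\<bar> < W" for k
    proof (induction k)
      case 0
      show ?case using u by simp
    next
      case (Suc k)
      have "norm (F ((F ^^ k) u) - F (Y k)) \<le> L * norm ((F ^^ k) u - Y k)"
        using D less_imp_le by (intro field_differentiable_bound[of UNIV F F']) (auto simp: abs_of_pos)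
      also have "\<dots> \<le> L * W"
        using Suc L by (intro mult_left_mono) auto
      finally have "\<bar>(F ^^ Suc k) u - Y (Suc k)\<bar> < 1 / 2"
        using Y_jump[of k] W(4) t(6) s_def unfolding funpow.simps o_apply real_norm_def by linarith
      then have "dist (circle_of ((F ^^ Suc k) u)) (circle_of (Y (Suc k))) = \<bar>(F ^^ Suc k) u - Y (Suc k)\<bar>"
        by (rule dist_circle_of_eq)
      then show ?case
        using p[of "Suc k"] circle_lift_apply[OF circle_lift_funpow[OF F(1)], of "Suc k" u] u(1) by simp
    qed
    \<comment> \<open>From time \<open>N\<close> on the pseudo-orbit is the true orbit of
      \<open>x\<close>, so the shadowing orbit stays close to it forever.\<close>
    have "\<bar>(F ^^ k) ((F ^^ N) u) - (F ^^ k) ((F ^^ N) x)\<bar> < 1" for k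
      using near[of "k + N"] Y_ge[of "k + N"] W(2) by (simp add: funpow_add)
    then have "(F ^^ N) u = (F ^^ N) x" by (rule expansive)
    then have "u = x"
      using strict_mono_funpow[OF F(2), of N] by (simp add: strict_mono_eq)
    define w where "w k = Y k - (F ^^ k) x" for k
    have w_less: "w k < W" for k
      using near[of k] by (simp add: w_def \<open>u = x\<close> abs_less_iff)
    have w_nonneg: "k \<le> N \<Longrightarrow> 0 \<le> w k" for k
    proof (induction rule: inc_induct)
      case base
      show ?case by (simp add: w_def Y_ge)
    next
      case (step k)
      then have "F ((F ^^ k) x) \<le> F (Y k)"
        using Y_step[of k] s by (simp add: w_def)
      then show ?case using F(2) by (simp add: w_def strict_mono_less_eq)
    qed
    define P where "P n = (\<Prod>i<n. F' ((F ^^ i) x) * (1 + V * W))" for n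
    have P_pos: "P n > 0" for n
      unfolding P_def using D(2) VW by (intro prod_pos) (auto intro: mult_pos_pos add_pos_pos)
    have w_step: "(w (Suc k) + s) / (F' ((F ^^ k) x) * (1 + V * W)) \<le> w k" if "k < N" for k
    proof -
      have "w (Suc k) + s = F (Y k) - F ((F ^^ k) x)"
        using Y_step[OF that] by (simp add: w_def)
      also have "\<dots> \<le> F' ((F ^^ k) x) * (1 + V * W) * w k"
      proof (cases "w k = 0")
        case True
        then show ?thesis by (simp add: w_def)
      next
        case False
        then have "(F ^^ k) x < Y k" using w_nonneg[of k] that by (simp add: w_def)
        then obtain z where z: "(F ^^ k) x < z" "z < Y k"
          "F (Y k) - F ((F ^^ k) x) = (Y k - (F ^^ k) x) * F' z"
          using MVT2[of "(F ^^ k) x" "Y k" F F'] D(1) by blast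
        have "F' z \<le> F' ((F ^^ k) x) * (1 + V * \<bar>z - (F ^^ k) x\<bar>)"
          by (rule V(2))
        also have "\<dots> \<le> F' ((F ^^ k) x) * (1 + V * W)"
          using z w_less[of k] V(1) D(2)[of "(F ^^ k) x"]
          by (intro mult_left_mono add_left_mono) (auto simp: w_def)
        finally have "F' z * w k \<le> F' ((F ^^ k) x) * (1 + V * W) * w k"
          using w_nonneg[of k] that by (intro mult_right_mono) auto
        then show ?thesis using z(3) by (simp add: w_def mult.commute)
      qed
      finally show ?thesis
        using D(2)[of "(F ^^ k) x"] VW by (simp add: pos_divide_le_eq add_pos_pos mult.commute)
    qed
    \<comment> \<open>Dividing the one-step inequality by \<open>P n\<close> makes it telescope: the
      error \<open>s\<close> of step \<open>j\<close> contributes \<open>s / P j\<close> to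
      \<open>w 0\<close>.\<close>
    have "w n / P n + s * (\<Sum>j=1..n. 1 / P j) \<le> w 0" if "n \<le> N" for n
      using that
    proof (induction n)
      case 0
      show ?case by (simp add: P_def)
    next
      case (Suc n)
      have P_Suc: "P (Suc n) = P n * (F' ((F ^^ n) x) * (1 + V * W))"
        by (simp add: P_def)
      have "(w (Suc n) + s) / P (Suc n) = (w (Suc n) + s) / (F' ((F ^^ n) x) * (1 + V * W)) / P n"
        by (simp add: P_Suc mult.commute)
      also have "\<dots> \<le> w n / P n"
        using w_step[of n] Suc.prems P_pos[of n] by (intro divide_right_mono) auto
      finally show ?case
        using Suc by (simp add: add_divide_distrib distrib_left)
    qed
    from this[of N] have "s * (\<Sum>j=1..N. 1 / P j) \<le> w 0"
      by (simp add: w_def Y_ge)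
    moreover have "1 / (2 * exp 1) \<le> 1 / P j" if "j \<in> {1..N}" for j
    proof -
      have "P j = (\<Prod>i<j. F' ((F ^^ i) x)) * (1 + V * W) ^ j"
        by (simp add: P_def prod.distrib)
      also have "\<dots> \<le> 2 * exp 1"
      proof (rule mult_mono)
        have "(1 + V * W) ^ j \<le> exp (V * W) ^ j"
          using VW by (intro power_mono exp_ge_add_one_self) auto
        also have "\<dots> = exp (real j * (V * W))"
          by (simp add: exp_of_nat_mult)
        also have "\<dots> \<le> exp 1"
          using that N(1) VW mult_right_mono[of "real j" "real N" "V * W"] by simp
        finally show "(1 + V * W) ^ j \<le> exp 1" .
      qed (use slow that VW in auto)
      finally show ?thesis using P_pos[of j] by (intro divide_left_mono) auto
    qed
    then have "(\<Sum>j=1..N. 1 / (2 * exp 1)) \<le> (\<Sum>j=1..N. 1 / P j)"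
      by (rule sum_mono)
    then have "s * (real N / (2 * exp 1)) \<le> s * (\<Sum>j=1..N. 1 / P j)"
      using s by (intro mult_left_mono) auto
    \<comment> \<open>This combines \<open>8 * exp 1 * V * W\<^sup>2 < t = 2 * s\<close> with
      \<open>N \<ge> 1 / (2 * (V * W))\<close>; it contradicts \<open>w 0 < W\<close>.\<close>
    moreover have "W \<le> s * (real N / (2 * exp 1))"
    proof -
      have "W = 8 * exp 1 * V * W\<^sup>2 / (8 * exp 1 * (V * W))"
        using V(1) W(1) by (simp add: power2_eq_square)
      also have "\<dots> \<le> t / (8 * exp 1 * (V * W))"
        using W(5) VW by (intro divide_right_mono) auto
      also have "\<dots> = s * (1 / (2 * (V * W)) / (2 * exp 1))"
        by (simp add: s_def)
      also have "\<dots> \<le> s * (real N / (2 * exp 1))"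
        using s N(2) by (intro mult_left_mono divide_right_mono) auto
      finally show ?thesis .
    qed
    ultimately show False using w_less[of 0] by linarith
  qed
  with N(3) show thesis by (rule that)
qed

text \<open>Cut the orbit into blocks of length at most \<open>N\<close> on which the derivative
  more than doubles, so each gains at least \<open>\<Lambda> ^ j\<close> with
  \<open>\<Lambda> = root N 2\<close>. The factor \<open>c = m ^ N / 2\<close> pays for the last
  incomplete block.\<close>

lemma exponential_growth:
  fixes F :: "real \<Rightarrow> real"
  assumes m: "0 < m" "m \<le> 1" "\<And>x. m \<le> F' x"
    and N: "N \<ge> 1" "\<And>x. \<exists>n\<in>{1..N}. 2 < (\<Prod>i<n. F' ((F ^^ i) x))"
  obtains c \<Lambda> :: real where "c > 0" "\<Lambda> > 1" "\<And>n x. c * \<Lambda> ^ n \<le> (\<Prod>i<n. F' ((F ^^ i) x))"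
proof -
  define \<Lambda> :: real where "\<Lambda> = root N 2"
  have \<Lambda>: "\<Lambda> > 1" "\<Lambda> ^ N = 2"
    using N(1) by (auto simp: \<Lambda>_def)
  define c where "c = m ^ N / 2"
  have c: "c > 0" using m by (simp add: c_def)
  have "c * \<Lambda> ^ n \<le> (\<Prod>i<n. F' ((F ^^ i) x))" for n x
  proof (induction n arbitrary: x rule: less_induct)
    case (less n)
    show ?case
    proof (cases "n < N")
      case True
      have "\<Lambda> ^ n \<le> \<Lambda> ^ N"
        using True \<Lambda>(1) by (intro power_increasing) auto
      then have "c * \<Lambda> ^ n \<le> m ^ N"
        using c mult_left_mono[of "\<Lambda> ^ n" 2 c] by (simp add: \<Lambda>(2) c_def)
      also have "\<dots> \<le> m ^ n"
        using True m by (intro power_decreasing) auto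
      also have "\<dots> = (\<Prod>i<n. m)" by simp
      also have "\<dots> \<le> (\<Prod>i<n. F' ((F ^^ i) x))"
        using m by (intro prod_mono) auto
      finally show ?thesis .
    next
      case False
      obtain j where j: "1 \<le> j" "j \<le> N" "2 < (\<Prod>i<j. F' ((F ^^ i) x))"
        using N(2)[of x] by auto
      define k where "k = n - j"
      have k: "n = j + k" "k < n" using j False N(1) by (auto simp: k_def)
      have "\<Lambda> ^ j \<le> 2"
        using j \<Lambda> power_increasing[of j N \<Lambda>] by simp
      then have "\<Lambda> ^ j * (c * \<Lambda> ^ k) \<le> (\<Prod>i<j. F' ((F ^^ i) x)) * (\<Prod>i<k. F' ((F ^^ i) ((F ^^ j) x)))"
        using j less[OF k(2), of "(F ^^ j) x"] c \<Lambda>(1) by (intro mult_mono) auto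
      also have "\<dots> = (\<Prod>i<j. F' ((F ^^ i) x)) * (\<Prod>i<k. F' ((F ^^ (j + i)) x))"
        by (simp add: funpow_add[of _ j] funpow_add[of j] add.commute)
      also have "\<dots> = (\<Prod>i<n. F' ((F ^^ i) x))"
        unfolding k(1) by (induction k) (simp_all add: mult.assoc)
      finally show ?thesis by (simp add: k(1) power_add ac_simps)
    qed
  qed
  with c \<Lambda>(1) show thesis by (rule that)
qed

theorem theorem1p7:
  fixes f :: "circle \<Rightarrow> circle" and \<alpha> :: real and r :: nat
  assumes "circle_C_class 2 f"
    and "orientation_preserving f"
    and "finite {c. turning_point f c}"
    and "1 / 2 < \<alpha>" and "\<alpha> \<le> 1"
    and "Holder_shadowing \<alpha> f"
    and "r \<ge> 1"
    and "robustly_transitive r f"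
  shows "expanding f"
proof -
  obtain F where F: "circle_lift f F" "C_class 2 F"
    using assms(1) unfolding circle_C_class_def by blast
  obtain F' F'' where D: "\<And>x. (F has_real_derivative F' x) (at x)"
    and D2: "\<And>x. (F' has_real_derivative F'' x) (at x)" and cont2: "continuous_on UNIV F''"
    using C_class_2_derivs[OF F(2)] by blast
  have cont1: "continuous_on S F'" for S
    using D2 by (meson DERIV_isCont continuous_at_imp_continuous_on)
  have degree: "circle_degree f > 0"
    using assms(2) by (simp add: orientation_preserving_def)
  obtain e where e: "e > 0" "\<And>g. C_close r e f g \<Longrightarrow> transitive g"
    using assms(8) unfolding robustly_transitive_def by blast
  have trans: "transitive f"
    using assms(8) e unfolding robustly_transitive_def circle_C_class_def C_close_def by fastforce
  \<comment> \<open>A critical point would make its value stable and hence \<open>f\<close>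
    injective, so of degree 1, against robust transitivity.\<close>
  have no_critical: "F' c \<noteq> 0" for c
  proof
    assume "F' c = 0"
    then obtain M where M: "M > 0" "\<And>x. \<bar>x - c\<bar> \<le> 1 \<Longrightarrow> \<bar>F x - F c\<bar> \<le> M * \<bar>x - c\<bar> ^ 2"
      using quadratic_bound_at_critical_point[OF D D2 cont2] by blast
    have "inj f"
      by (rule inj_if_transitive_and_stable_point[OF trans circle_lift_isCont[OF F(1)]
            critical_value_stable[OF F(1) M assms(4,6)]])
    then show False
      using circle_lift_inj[OF F(1) degree] not_robustly_transitive_if_degree_1[OF F(1)] assms(8) by blast
  qed
  have F'_pos: "F' x > 0" for x
  proof -
    have "F 1 > F 0" using circle_degree_lift[OF F(1), of 0] degree by simp
    moreover obtain z where "F 1 - F 0 = (1 - 0) * F' z"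
      using MVT2[of 0 1 F F'] D by auto
    ultimately have z: "F' z > 0" by simp
    show ?thesis
    proof (rule ccontr)
      assume "\<not> F' x > 0"
      moreover have "connected (F' ` UNIV)"
        using cont1 by (intro connected_continuous_image connected_UNIV)
      ultimately have "0 \<in> F' ` UNIV"
        using z connectedD_interval[of "F' ` UNIV" "F' x" "F' z" 0] by auto
      then show False using no_critical by auto
    qed
  qed
  have mono: "strict_mono F"
    unfolding strict_mono_def using DERIV_pos_imp_increasing[of _ _ F] D F'_pos by blast
  then have degree2: "circle_degree f \<ge> 2"
    using not_robustly_transitive_if_degree_1[OF F(1) mono] assms(8) degree by force
  have expansive: "x = y" if "\<And>k. \<bar>(F ^^ k) x - (F ^^ k) y\<bar> < 1" for x y
    using expansive_if_transitive[OF F(1) mono degree2 trans that] .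
  have "surj F"
    unfolding surj_def
  proof
    fix y
    \<comment> \<open>As the degree is at least 1, \<open>F\<close> moves by at least
      \<open>k\<close> over \<open>[0, k]\<close> and over \<open>[-k, 0]\<close>, so its values at
      \<open>-k\<close> and \<open>k\<close> enclose \<open>y\<close>.\<close>
    define k where "k = \<lceil>\<bar>y - F 0\<bar>\<rceil>"
    have k: "\<bar>y - F 0\<bar> \<le> of_int k" "0 \<le> k" by (auto simp: k_def)
    have "of_int k \<le> real_of_int (circle_degree f * k)"
      using degree k(2) mult_right_mono[of 1 "circle_degree f" k] by linarith
    then have "F (of_int (- k)) \<le> y" "y \<le> F (of_int k)"
      using circle_degree_lift_int[OF F(1), of 0 k] circle_degree_lift_int[OF F(1), of 0 "- k"] k by auto
    then show "\<exists>x. y = F x"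
      using IVT'[of F "of_int (- k)" y "of_int k"] k continuous_on_subset[OF circle_lift_continuous[OF F(1)]]
      by auto
  qed
  have periodic1: "F' (x + 1) = F' x" for x
  proof -
    have "((\<lambda>x. F (x + 1)) has_real_derivative F' (x + 1)) (at x)"
      using D[of "x + 1"] by (simp add: DERIV_shift)
    then have "((\<lambda>x. F x + of_int (circle_degree f)) has_real_derivative F' (x + 1)) (at x)"
      by (simp add: circle_degree_lift[OF F(1)])
    then show ?thesis
      unfolding has_real_derivative_add_const_iff using D by (rule DERIV_unique)
  qed
  have periodic2: "F'' (x + 1) = F'' x" for x
  proof -
    have "((\<lambda>x. F' (x + 1)) has_real_derivative F'' (x + 1)) (at x)"
      using D2[of "x + 1"] by (simp add: DERIV_shift)
    then show ?thesis
      using D2 by (simp add: periodic1 DERIV_unique)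
  qed
  obtain L where L: "L > 0" "\<And>x. \<bar>F' x\<bar> \<le> L"
    using periodic_bounded[of F'] cont1 periodic1 by blast
  obtain M where M: "M > 0" "\<And>x. \<bar>F'' x\<bar> \<le> M"
    using periodic_bounded[of F''] cont2 periodic2 by blast
  have "continuous_on UNIV (\<lambda>x. 1 / F' x)"
    using no_critical by (intro continuous_intros cont1) auto
  then obtain B where B: "B > 0" "\<And>x. \<bar>1 / F' x\<bar> \<le> B"
    by (rule periodic_bounded) (simp_all add: periodic1)
  have F'_B: "1 \<le> F' x * B" for x
    using B(2)[of x] F'_pos[of x] by (simp add: field_simps)
  \<comment> \<open>\<open>M\<close> is a Lipschitz constant of \<open>F'\<close>, and
    \<open>B\<close>, a bound for \<open>1 / F'\<close>, turns the additive error into a relative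
    one.\<close>
  have distortion: "F' y \<le> F' x * (1 + (B * M) * \<bar>y - x\<bar>)" for x y
  proof -
    have "norm (F' y - F' x) \<le> M * norm (y - x)"
      using D2 M by (intro field_differentiable_bound[of UNIV F' F'']) auto
    then have "F' y \<le> F' x + M * \<bar>y - x\<bar>" by auto
    also have "M * \<bar>y - x\<bar> \<le> (F' x * B) * (M * \<bar>y - x\<bar>)"
      using F'_B[of x] M mult_right_mono[of 1 "F' x * B" "M * \<bar>y - x\<bar>"] by simp
    finally show ?thesis by (simp add: algebra_simps)
  qed
  obtain N where N: "N \<ge> 1" "\<And>x. \<exists>n\<in>{1..N}. 2 < (\<Prod>i<n. F' ((F ^^ i) x))"
  proof (rule uniform_growth[OF F(1) mono \<open>surj F\<close> D F'_pos _ _ distortion expansive assms(4,6)])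
    show "F' x \<le> L" for x using L(2)[of x] by simp
    show "0 < B * M" using B M by simp
  qed (assumption | rule that)+
  define m where "m = min 1 (1 / B)"
  have m: "0 < m" "m \<le> 1" "m \<le> F' x" for x
    using B(1) F'_B[of x] by (auto simp: m_def min_le_iff_disj field_simps)
  obtain c \<Lambda> :: real where c: "c > 0" "\<Lambda> > 1" "\<And>n x. c * \<Lambda> ^ n \<le> (\<Prod>i<n. F' ((F ^^ i) x))"
    using exponential_growth[where F = F and F' = F', OF m N] by blast
  \<comment> \<open>Halving \<open>c\<close> turns the weak inequality into the strict one of
    \<open>expanding\<close>.\<close>
  have "\<bar>circle_deriv (f ^^ n) p\<bar> > c / 2 * \<Lambda> ^ n" for p n
  proof -
    obtain x where x: "circle_of x = p" using circle_of_surj by blast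
    have "circle_deriv (f ^^ n) p = (\<Prod>i<n. F' ((F ^^ i) x))"
      unfolding x[symmetric]
      by (rule circle_deriv_lift[OF circle_lift_funpow[OF F(1)] has_real_derivative_funpow[OF D]])
    moreover have "0 < c * \<Lambda> ^ n" using c by simp
    ultimately show ?thesis using c(3)[of n x] by simp
  qed
  then show ?thesis
    unfolding expanding_def using c by (intro exI[of _ "c / 2"] conjI exI[of _ \<Lambda>]) auto
qed

end
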